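(* Let $\mathbb{X}$ be an extensive restriction category and let $\mathsf{Iter}$ be a family of operators $\mathsf{Iter}^X_A:\mathbb{X}(X,X+A)\to\mathbb{X}(X,A)$. For $f_1:X\to X$, $f_2:X\to A$ with $f_1\perp_df_2$ write $[f_1\,|\,f_2]:=\mathsf{Iter}^X_A\big(\begin{bmatrix}f_1&f_2\end{bmatrix}\big)$. Then $\mathsf{Iter}$ is a parametrized iteration operator if and only if the following hold: (a) $f_2\sqcup f_1[f_1\,|\,f_2]=[f_1\,|\,f_2]$ for all $f_1:X\to X$, $f_2:X\to A$ with $f_1\perp_df_2$; (b) $[f_1\,|\,f_2h]=[f_1\,|\,f_2]h$ for all $f_1:X\to X$, $f_2:X\to A'$ with $f_1\perp_df_2$ and all $h:A'\to A$; (c) $[kf_1\,|\,kf_2]=k[f_1k\,|\,f_2]$ for all $f_1:X'\to X$, $f_2:X'\to A$ with $f_1\perp_df_2$ and all $k:X\to X'$; (d) $\big[[f_1\,|\,f_2]\,\big|\,[f_1\,|\,f_3]\big]=[f_1\sqcup f_2\,|\,f_3]$ for all decision disjoint families $\{f_1:X\to X,\ f_2:X\to X,\ f_3:X\to A\}$ (the left-hand side being defined, i.e. $[f_1\,|\,f_2]\perp_d[f_1\,|\,f_3]$, as a consequence of (b)). Moreover $\mathsf{Iter}$ is a uniform parametrized iteration operator if and only if (a)–(d) hold together with: (e) for all $f_1:X\to X$, $f_2:X\to A$ with $f_1\perp_df_2$, all $f_1':Y\to Y$, $f_2':Y\to A$ with $f_1'\perp_df_2'$, and all $h:X\to Y$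 with $hf_1'=f_1h$ and $f_2=hf_2'$, one has $[f_1\,|\,f_2]=h[f_1'\,|\,f_2']$.
   Context: Composition is diagrammatic: $fg$ means first $f$, then $g$. A restriction category is a category with an operator sending each $f:A\to B$ to $\overline{f}:A\to A$ such that $\overline{f}f=f$; $\overline{f}\,\overline{g}=\overline{g}\,\overline{f}$ and $\overline{\overline{g}f}=\overline{g}\,\overline{f}$ for $f:A\to B$, $g:A\to C$; and $f\overline{g}=\overline{fg}f$ for $f:A\to B$, $g:B\to C$. For parallel $f,g$: $f\le g$ iff $\overline{f}g=f$. A map $f:A\to B$ is total if $\overline{f}=1_A$. Restriction zeroes: maps $0:A\to B$ with $f0=0=0f$ and $\overline{0}=0$. A coCartesian restriction category is a restriction category with finite coproducts whose injections $\iota_j$ are total. With restriction zeroes, the quasi-projection $\iota_j^\circ:A_1+\dots+A_n\to A_j$ is the unique map with $\iota_j\iota_j^\circ=1_{A_j}$ and $\iota_i\iota_j^\circ=0$ for $i\ne j$. $\nabla:A+\dots+A\to A$ is the codiagonal; copairing is written as a column. An extensive restriction category is a coCartesian restriction category with restriction zeroes such that for every $f:A\to B_1+\dots+B_n$ there is a (necessarily unique) map $\langle f\rangle:A\to A+\dots+A$ ($n$ copies) with $\overline{f}=\langle f\rangle\nabla$ and $\langle f\rangle(f+\dots+f)=f(\iota_1+\dots+\iota_n)$. A map $d:A\to A+\dots+A$ is a decision if $\langle d\rangle=d$. A family of maps $f_j:A\to B_j$ ($1\le j\le n$) is decision disjoint if there is a (necessarily unique) decision $\langle f_1\vert\dots\vert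 f_n\rangle:A\to A+\dots+A$ with $\langle f_1\vert\dots\vert f_n\rangle\iota_j^\circ=\overline{f_j}$ for all $j$; for $n=2$ write $f_1\perp_df_2$. The relation $\perp_d$ is an interference relation with all binary joins: for parallel $f\perp_d g:A\to B$, $f\sqcup g:=\langle f\vert g\rangle(f+g)\nabla$ is their least upper bound for $\le$, preserved by precomposition. For a decision disjoint family, $\begin{bmatrix} f_1&\cdots&f_n\end{bmatrix}:=\langle f_1\vert\dots\vert f_n\rangle(f_1+\dots+f_n):A\to B_1+\dots+B_n$; every map $h:A\to B_1+\dots+B_n$ is uniquely of this form, with $f_j=h\iota_j^\circ$. A parametrized iteration operator on a category with finite coproducts is a family of operators $\mathsf{Iter}^X_A$ sending $f:X\to X+A$ to $\mathsf{Iter}^X_A(f):X\to A$ such that: [Parametrized Iteration] $f\left[\begin{smallmatrix}\mathsf{Iter}^X_A(f)\\ 1_A\end{smallmatrix}\right]=\mathsf{Iter}^X_A(f)$; [Naturality] $\mathsf{Iter}^X_A(f(1_X+h))=\mathsf{Iter}^X_{A'}(f)h$ for $f:X\to X+A'$, $h:A'\to A$; [Dinaturality] $\mathsf{Iter}^X_A(kf)=k\,\mathsf{Iter}^{X'}_A(f(k+1_A))$ for $f:X'\to X+A$, $k:X\to X'$; [Diagonal] $\mathsf{Iter}^X_A(\mathsf{Iter}^X_{X+A}(f))=\mathsf{Iter}^X_A(f(\nabla_X+1_A))$ for $f:X\to X+X+A$. It is uniform if $f(h+1_A)=hf'$ (with $f:X\to X+A$, $f':Y\to Y+A$, $h:X\to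 Y$) implies $\mathsf{Iter}^X_A(f)=h\,\mathsf{Iter}^Y_A(f')$. *)

theory Defs
  imports Main
begin

text \<open>
  Composition is diagrammatic: \<open>f \<cdot> g\<close> is first \<open>f\<close>, then \<open>g\<close>.
  Finite coproducts are chosen for every finite list of objects, so \<open>A\<^sub>1 + \<dots> + A\<^sub>n\<close> is
  \<open>Cop C [A\<^sub>1, \<dots>, A\<^sub>n]\<close>; indices of injections and of families start at 0.
\<close>

record ('o, 'a) category_data =
  Obj :: "'o set"
  Arr :: "'a set"
  Dom :: "'a \<Rightarrow> 'o"
  Cod :: "'a \<Rightarrow> 'o"
  Id :: "'o \<Rightarrow> 'a"
  Comp :: "'a \<Rightarrow> 'a \<Rightarrow> 'a"  (infixl "\<cdot>\<index>" 70)

record ('o, 'a) restriction_data = "('o, 'a) category_data" +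
  Rst :: "'a \<Rightarrow> 'a"

record ('o, 'a) cocartesian_data = "('o, 'a) restriction_data" +
  Cop :: "'o list \<Rightarrow> 'o"
  Inj :: "'o list \<Rightarrow> nat \<Rightarrow> 'a"

record ('o, 'a) extensive_data = "('o, 'a) cocartesian_data" +
  Zero :: "'o \<Rightarrow> 'o \<Rightarrow> 'a"

definition Hom :: "('o, 'a, 'm) category_data_scheme \<Rightarrow> 'o \<Rightarrow> 'o \<Rightarrow> 'a set" where
  "Hom C A B = {f \<in> Arr C. Dom C f = A \<and> Cod C f = B}"

locale category =
  fixes C :: "('o, 'a, 'm) category_data_scheme" (structure)
  assumes Dom_Obj: "f \<in> Arr C \<Longrightarrow> Dom C f \<in> Obj C"
    and Cod_Obj: "f \<in> Arr C \<Longrightarrow> Cod C f \<in> Obj C"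
    and Id_Hom: "A \<in> Obj C \<Longrightarrow> Id C A \<in> Hom C A A"
    and Comp_Hom: "f \<in> Hom C A B \<Longrightarrow> g \<in> Hom C B D \<Longrightarrow> f \<cdot> g \<in> Hom C A D"
    and Id_Comp: "f \<in> Hom C A B \<Longrightarrow> Id C A \<cdot> f = f"
    and Comp_Id: "f \<in> Hom C A B \<Longrightarrow> f \<cdot> Id C B = f"
    and Comp_assoc:
      "f \<in> Hom C A B \<Longrightarrow> g \<in> Hom C B D \<Longrightarrow> h \<in> Hom C D E \<Longrightarrow> (f \<cdot> g) \<cdot> h = f \<cdot> (g \<cdot> h)"

locale restriction_category = category C
  for C :: "('o, 'a, 'm) restriction_data_scheme" (structure) +
  assumes Rst_Hom: "f \<in> Hom C A B \<Longrightarrow> Rst C f \<in> Hom C A A"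
    and Rst_Comp: "f \<in> Hom C A B \<Longrightarrow> Rst C f \<cdot> f = f"
    and Rst_commute:
      "f \<in> Hom C A B \<Longrightarrow> g \<in> Hom C A D \<Longrightarrow> Rst C f \<cdot> Rst C g = Rst C g \<cdot> Rst C f"
    and Rst_Rst_Comp:
      "f \<in> Hom C A B \<Longrightarrow> g \<in> Hom C A D \<Longrightarrow> Rst C (Rst C g \<cdot> f) = Rst C g \<cdot> Rst C f"
    and Comp_Rst:
      "f \<in> Hom C A B \<Longrightarrow> g \<in> Hom C B D \<Longrightarrow> f \<cdot> Rst C g = Rst C (f \<cdot> g) \<cdot> f"

definition total :: "('o, 'a, 'm) restriction_data_scheme \<Rightarrow> 'a \<Rightarrow> bool" where
  "total C f \<longleftrightarrow> f \<in> Arr C \<and> Rst C f = Id C (Dom C f)"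

locale cocartesian_restriction_category = restriction_category C
  for C :: "('o, 'a, 'm) cocartesian_data_scheme" (structure) +
  assumes Cop_Obj: "set As \<subseteq> Obj C \<Longrightarrow> Cop C As \<in> Obj C"
    and Inj_Hom: "set As \<subseteq> Obj C \<Longrightarrow> j < length As \<Longrightarrow> Inj C As j \<in> Hom C (As ! j) (Cop C As)"
    and Cop_universal:
      "set As \<subseteq> Obj C \<Longrightarrow> B \<in> Obj C \<Longrightarrow> length gs = length As \<Longrightarrow>
       (\<And>j. j < length As \<Longrightarrow> gs ! j \<in> Hom C (As ! j) B) \<Longrightarrow>
       \<exists>!h. h \<in> Hom C (Cop C As) B \<and> (\<forall>j<length As. Inj C As j \<cdot> h = gs ! j)"
    and Inj_total: "set As \<subseteq> Obj C \<Longrightarrow> j < length As \<Longrightarrow> total C (Inj C As j)"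

text \<open>The codomain \<open>B\<close> is an argument because the empty copairing does not determine it.\<close>

definition copair :: "('o, 'a, 'm) cocartesian_data_scheme \<Rightarrow> 'o \<Rightarrow> 'a list \<Rightarrow> 'a" where
  "copair C B gs =
     (THE h. h \<in> Hom C (Cop C (map (Dom C) gs)) B \<and>
             (\<forall>j<length gs. Inj C (map (Dom C) gs) j \<cdot>\<^bsub>C\<^esub> h = gs ! j))"

definition cosum :: "('o, 'a, 'm) cocartesian_data_scheme \<Rightarrow> 'a list \<Rightarrow> 'a" where
  "cosum C fs =
     copair C (Cop C (map (Cod C) fs))
       (map (\<lambda>j. fs ! j \<cdot>\<^bsub>C\<^esub> Inj C (map (Cod C) fs) j) [0..<length fs])"

definition codiag :: "('o, 'a, 'm) cocartesian_data_scheme \<Rightarrow> nat \<Rightarrow> 'o \<Rightarrow> 'a" where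
  "codiag C n A = copair C A (replicate n (Id C A))"

text \<open>
  The canonical comparison maps \<open>X + Y + Z \<rightarrow> X + (Y + Z)\<close> and \<open>X + Y + Z \<rightarrow> (X + Y) + Z\<close> from
  the ternary coproduct, which are left implicit in informal notation.
\<close>

definition assoc_right :: "('o, 'a, 'm) cocartesian_data_scheme \<Rightarrow> 'o \<Rightarrow> 'o \<Rightarrow> 'o \<Rightarrow> 'a" where
  "assoc_right C X Y Z =
     copair C (Cop C [X, Cop C [Y, Z]])
       [Inj C [X, Cop C [Y, Z]] 0,
        Inj C [Y, Z] 0 \<cdot>\<^bsub>C\<^esub> Inj C [X, Cop C [Y, Z]] 1,
        Inj C [Y, Z] 1 \<cdot>\<^bsub>C\<^esub> Inj C [X, Cop C [Y, Z]] 1]"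

definition assoc_left :: "('o, 'a, 'm) cocartesian_data_scheme \<Rightarrow> 'o \<Rightarrow> 'o \<Rightarrow> 'o \<Rightarrow> 'a" where
  "assoc_left C X Y Z =
     copair C (Cop C [Cop C [X, Y], Z])
       [Inj C [X, Y] 0 \<cdot>\<^bsub>C\<^esub> Inj C [Cop C [X, Y], Z] 0,
        Inj C [X, Y] 1 \<cdot>\<^bsub>C\<^esub> Inj C [Cop C [X, Y], Z] 0,
        Inj C [Cop C [X, Y], Z] 1]"

definition quasi_proj :: "('o, 'a, 'm) extensive_data_scheme \<Rightarrow> 'o list \<Rightarrow> nat \<Rightarrow> 'a" where
  "quasi_proj C As j =
     (THE p. p \<in> Hom C (Cop C As) (As ! j) \<and>
             Inj C As j \<cdot>\<^bsub>C\<^esub> p = Id C (As ! j) \<and>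
             (\<forall>i<length As. i \<noteq> j \<longrightarrow> Inj C As i \<cdot>\<^bsub>C\<^esub> p = Zero C (As ! i) (As ! j)))"

text \<open>
  \<open>is_bracket C Bs f d\<close> says that \<open>d\<close> satisfies the defining equations of \<open>\<langle>f\<rangle>\<close> for
  \<open>f : A \<rightarrow> Cop C Bs\<close>. The list \<open>Bs\<close> is an argument because \<open>Cop C\<close> need not be injective.
\<close>

definition is_bracket ::
    "('o, 'a, 'm) cocartesian_data_scheme \<Rightarrow> 'o list \<Rightarrow> 'a \<Rightarrow> 'a \<Rightarrow> bool" where
  "is_bracket C Bs f d \<longleftrightarrow>
     d \<in> Hom C (Dom C f) (Cop C (replicate (length Bs) (Dom C f))) \<and>
     Rst C f = d \<cdot>\<^bsub>C\<^esub> codiag C (length Bs) (Dom C f) \<and>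
     d \<cdot>\<^bsub>C\<^esub> cosum C (replicate (length Bs) f) =
       f \<cdot>\<^bsub>C\<^esub> cosum C (map (Inj C Bs) [0..<length Bs])"

locale extensive_restriction_category = cocartesian_restriction_category C
  for C :: "('o, 'a, 'm) extensive_data_scheme" (structure) +
  assumes Zero_Hom: "A \<in> Obj C \<Longrightarrow> B \<in> Obj C \<Longrightarrow> Zero C A B \<in> Hom C A B"
    and Comp_Zero: "f \<in> Hom C A B \<Longrightarrow> D \<in> Obj C \<Longrightarrow> f \<cdot> Zero C B D = Zero C A D"
    and Zero_Comp: "f \<in> Hom C A B \<Longrightarrow> D \<in> Obj C \<Longrightarrow> Zero C D A \<cdot> f = Zero C D B"
    and Rst_Zero: "A \<in> Obj C \<Longrightarrow> B \<in> Obj C \<Longrightarrow> Rst C (Zero C A B) = Zero C A A"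
    and ex_bracket: "set Bs \<subseteq> Obj C \<Longrightarrow> f \<in> Hom C A (Cop C Bs) \<Longrightarrow> \<exists>d. is_bracket C Bs f d"

definition bracket :: "('o, 'a, 'm) cocartesian_data_scheme \<Rightarrow> 'o list \<Rightarrow> 'a \<Rightarrow> 'a" where
  "bracket C Bs f = (THE d. is_bracket C Bs f d)"

definition decision ::
    "('o, 'a, 'm) cocartesian_data_scheme \<Rightarrow> nat \<Rightarrow> 'o \<Rightarrow> 'a \<Rightarrow> bool" where
  "decision C n A d \<longleftrightarrow>
     d \<in> Hom C A (Cop C (replicate n A)) \<and> bracket C (replicate n A) d = d"

definition is_family_decision ::
    "('o, 'a, 'm) extensive_data_scheme \<Rightarrow> 'o \<Rightarrow> 'a list \<Rightarrow> 'a \<Rightarrow> bool" where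
  "is_family_decision C A fs d \<longleftrightarrow>
     decision C (length fs) A d \<and>
     (\<forall>j<length fs. d \<cdot>\<^bsub>C\<^esub> quasi_proj C (replicate (length fs) A) j = Rst C (fs ! j))"

definition decision_disjoint ::
    "('o, 'a, 'm) extensive_data_scheme \<Rightarrow> 'o \<Rightarrow> 'a list \<Rightarrow> bool" where
  "decision_disjoint C A fs \<longleftrightarrow>
     (\<forall>f\<in>set fs. f \<in> Arr C \<and> Dom C f = A) \<and> (\<exists>d. is_family_decision C A fs d)"

definition family_decision ::
    "('o, 'a, 'm) extensive_data_scheme \<Rightarrow> 'o \<Rightarrow> 'a list \<Rightarrow> 'a" where
  "family_decision C A fs = (THE d. is_family_decision C A fs d)"

definition perp :: "('o, 'a, 'm) extensive_data_scheme \<Rightarrow> 'a \<Rightarrow> 'a \<Rightarrow> bool" where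
  "perp C f g \<longleftrightarrow> decision_disjoint C (Dom C f) [f, g]"

definition row :: "('o, 'a, 'm) extensive_data_scheme \<Rightarrow> 'o \<Rightarrow> 'a list \<Rightarrow> 'a" where
  "row C A fs = family_decision C A fs \<cdot>\<^bsub>C\<^esub> cosum C fs"

definition join :: "('o, 'a, 'm) extensive_data_scheme \<Rightarrow> 'a \<Rightarrow> 'a \<Rightarrow> 'a"
    (infixl "\<squnion>\<index>" 65) where
  "f \<squnion>\<^bsub>C\<^esub> g =
     family_decision C (Dom C f) [f, g] \<cdot>\<^bsub>C\<^esub> cosum C [f, g] \<cdot>\<^bsub>C\<^esub> codiag C 2 (Cod C f)"

definition operator_family ::
    "('o, 'a, 'm) cocartesian_data_scheme \<Rightarrow> ('o \<Rightarrow> 'o \<Rightarrow> 'a \<Rightarrow> 'a) \<Rightarrow> bool" where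
  "operator_family C Iter \<longleftrightarrow>
     (\<forall>X\<in>Obj C. \<forall>A\<in>Obj C. \<forall>f\<in>Hom C X (Cop C [X, A]). Iter X A f \<in> Hom C X A)"

definition parametrized_iteration_operator ::
    "('o, 'a, 'm) cocartesian_data_scheme \<Rightarrow> ('o \<Rightarrow> 'o \<Rightarrow> 'a \<Rightarrow> 'a) \<Rightarrow> bool" where
  "parametrized_iteration_operator C Iter \<longleftrightarrow>
     operator_family C Iter \<and>
     (\<forall>X\<in>Obj C. \<forall>A\<in>Obj C. \<forall>f\<in>Hom C X (Cop C [X, A]).
        f \<cdot>\<^bsub>C\<^esub> copair C A [Iter X A f, Id C A] = Iter X A f) \<and>
     (\<forall>X\<in>Obj C. \<forall>A'\<in>Obj C. \<forall>A\<in>Obj C. \<forall>f\<in>Hom C X (Cop C [X, A']). \<forall>h\<in>Hom C A' A.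
        Iter X A (f \<cdot>\<^bsub>C\<^esub> cosum C [Id C X, h]) = Iter X A' f \<cdot>\<^bsub>C\<^esub> h) \<and>
     (\<forall>X\<in>Obj C. \<forall>X'\<in>Obj C. \<forall>A\<in>Obj C. \<forall>f\<in>Hom C X' (Cop C [X, A]). \<forall>k\<in>Hom C X X'.
        Iter X A (k \<cdot>\<^bsub>C\<^esub> f) = k \<cdot>\<^bsub>C\<^esub> Iter X' A (f \<cdot>\<^bsub>C\<^esub> cosum C [k, Id C A])) \<and>
     (\<forall>X\<in>Obj C. \<forall>A\<in>Obj C. \<forall>f\<in>Hom C X (Cop C [X, X, A]).
        Iter X A (Iter X (Cop C [X, A]) (f \<cdot>\<^bsub>C\<^esub> assoc_right C X X A)) =
        Iter X A (f \<cdot>\<^bsub>C\<^esub> assoc_left C X X A \<cdot>\<^bsub>C\<^esub> cosum C [codiag C 2 X, Id C A]))"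

definition uniform ::
    "('o, 'a, 'm) cocartesian_data_scheme \<Rightarrow> ('o \<Rightarrow> 'o \<Rightarrow> 'a \<Rightarrow> 'a) \<Rightarrow> bool" where
  "uniform C Iter \<longleftrightarrow>
     (\<forall>X\<in>Obj C. \<forall>Y\<in>Obj C. \<forall>A\<in>Obj C.
      \<forall>f\<in>Hom C X (Cop C [X, A]). \<forall>f'\<in>Hom C Y (Cop C [Y, A]). \<forall>h\<in>Hom C X Y.
        f \<cdot>\<^bsub>C\<^esub> cosum C [h, Id C A] = h \<cdot>\<^bsub>C\<^esub> f' \<longrightarrow> Iter X A f = h \<cdot>\<^bsub>C\<^esub> Iter Y A f')"

text \<open>\<open>wand C Iter f\<^sub>1 f\<^sub>2\<close> is \<open>[f\<^sub>1 | f\<^sub>2]\<close>.\<close>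

definition wand ::
    "('o, 'a, 'm) extensive_data_scheme \<Rightarrow> ('o \<Rightarrow> 'o \<Rightarrow> 'a \<Rightarrow> 'a) \<Rightarrow> 'a \<Rightarrow> 'a \<Rightarrow> 'a" where
  "wand C Iter f1 f2 = Iter (Dom C f1) (Cod C f2) (row C (Dom C f1) [f1, f2])"

definition wand_iteration ::
    "('o, 'a, 'm) extensive_data_scheme \<Rightarrow> ('o \<Rightarrow> 'o \<Rightarrow> 'a \<Rightarrow> 'a) \<Rightarrow> bool" where
  "wand_iteration C Iter \<longleftrightarrow>
     (\<forall>X\<in>Obj C. \<forall>A\<in>Obj C. \<forall>f1\<in>Hom C X X. \<forall>f2\<in>Hom C X A. perp C f1 f2 \<longrightarrow>
        f2 \<squnion>\<^bsub>C\<^esub> (f1 \<cdot>\<^bsub>C\<^esub> wand C Iter f1 f2) = wand C Iter f1 f2)"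

definition wand_naturality ::
    "('o, 'a, 'm) extensive_data_scheme \<Rightarrow> ('o \<Rightarrow> 'o \<Rightarrow> 'a \<Rightarrow> 'a) \<Rightarrow> bool" where
  "wand_naturality C Iter \<longleftrightarrow>
     (\<forall>X\<in>Obj C. \<forall>A'\<in>Obj C. \<forall>A\<in>Obj C.
      \<forall>f1\<in>Hom C X X. \<forall>f2\<in>Hom C X A'. \<forall>h\<in>Hom C A' A. perp C f1 f2 \<longrightarrow>
        wand C Iter f1 (f2 \<cdot>\<^bsub>C\<^esub> h) = wand C Iter f1 f2 \<cdot>\<^bsub>C\<^esub> h)"

definition wand_dinaturality ::
    "('o, 'a, 'm) extensive_data_scheme \<Rightarrow> ('o \<Rightarrow> 'o \<Rightarrow> 'a \<Rightarrow> 'a) \<Rightarrow> bool" where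
  "wand_dinaturality C Iter \<longleftrightarrow>
     (\<forall>X\<in>Obj C. \<forall>X'\<in>Obj C. \<forall>A\<in>Obj C.
      \<forall>f1\<in>Hom C X' X. \<forall>f2\<in>Hom C X' A. \<forall>k\<in>Hom C X X'. perp C f1 f2 \<longrightarrow>
        wand C Iter (k \<cdot>\<^bsub>C\<^esub> f1) (k \<cdot>\<^bsub>C\<^esub> f2) = k \<cdot>\<^bsub>C\<^esub> wand C Iter (f1 \<cdot>\<^bsub>C\<^esub> k) f2)"

definition wand_diagonal ::
    "('o, 'a, 'm) extensive_data_scheme \<Rightarrow> ('o \<Rightarrow> 'o \<Rightarrow> 'a \<Rightarrow> 'a) \<Rightarrow> bool" where
  "wand_diagonal C Iter \<longleftrightarrow>
     (\<forall>X\<in>Obj C. \<forall>A\<in>Obj C.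
      \<forall>f1\<in>Hom C X X. \<forall>f2\<in>Hom C X X. \<forall>f3\<in>Hom C X A. decision_disjoint C X [f1, f2, f3] \<longrightarrow>
        wand C Iter (wand C Iter f1 f2) (wand C Iter f1 f3) = wand C Iter (f1 \<squnion>\<^bsub>C\<^esub> f2) f3)"

definition wand_uniformity ::
    "('o, 'a, 'm) extensive_data_scheme \<Rightarrow> ('o \<Rightarrow> 'o \<Rightarrow> 'a \<Rightarrow> 'a) \<Rightarrow> bool" where
  "wand_uniformity C Iter \<longleftrightarrow>
     (\<forall>X\<in>Obj C. \<forall>Y\<in>Obj C. \<forall>A\<in>Obj C.
      \<forall>f1\<in>Hom C X X. \<forall>f2\<in>Hom C X A. \<forall>f1'\<in>Hom C Y Y. \<forall>f2'\<in>Hom C Y A. \<forall>h\<in>Hom C X Y.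
        perp C f1 f2 \<longrightarrow> perp C f1' f2' \<longrightarrow> h \<cdot>\<^bsub>C\<^esub> f1' = f1 \<cdot>\<^bsub>C\<^esub> h \<longrightarrow> f2 = h \<cdot>\<^bsub>C\<^esub> f2' \<longrightarrow>
        wand C Iter f1 f2 = h \<cdot>\<^bsub>C\<^esub> wand C Iter f1' f2')"

end

theory Submission
  imports Defs
begin

text \<open>
  The quasi-projections are jointly monic. Indeed, for \<open>h : A \<rightarrow> B\<^sub>1 + \<dots> + B\<^sub>n\<close> any \<open>d = \<langle>h\<rangle>\<close>
  satisfies \<open>d (h \<iota>\<^sub>1\<degree> + \<dots> + h \<iota>\<^sub>n\<degree>) = h\<close>, so \<open>d\<close> is unchanged by postcomposition with the
  restriction of \<open>h \<iota>\<^sub>1\<degree> + \<dots> + h \<iota>\<^sub>n\<degree>\<close>. As the restriction of \<open>h\<close> is \<open>d \<nabla>\<close>, two maps that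
  agree on the restriction of each \<open>h \<iota>\<^sub>j\<degree>\<close> agree on the restriction of \<open>h\<close>.

  Hence decisions are exactly the maps whose components are restriction idempotents, decision
  disjoint families correspond bijectively to maps into coproducts, and every equation between
  maps into a coproduct can be checked on components. The axioms (a), (b), (c) and (e) are the
  component forms of the corresponding axioms of \<open>Iter\<close>. For (d), naturality identifies the
  components of \<open>Iter\<close> applied to \<open>X \<rightarrow> X + (X + A)\<close> as \<open>[f\<^sub>1 | f\<^sub>2]\<close> and \<open>[f\<^sub>1 | f\<^sub>3]\<close>.
\<close>

lemma replicate_2: "replicate 2 x = [x, x]"
  by (simp add: numeral_2_eq_2)

section \<open>Typing and rewriting rules in a category\<close>

context category
begin

text \<open>Unfolding hom-sets into source and target equations lets the simplifier compute the type
  of every composite.\<close>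

lemma Hom_iff [simp]: "f \<in> Hom C A B \<longleftrightarrow> f \<in> Arr C \<and> Dom C f = A \<and> Cod C f = B"
  by (simp add: Hom_def)

lemma Dom_in_Obj [simp]: "f \<in> Arr C \<Longrightarrow> Dom C f \<in> Obj C"
  and Cod_in_Obj [simp]: "f \<in> Arr C \<Longrightarrow> Cod C f \<in> Obj C"
  by (rule Dom_Obj, assumption) (rule Cod_Obj)

lemma Id_typing [simp]:
  assumes "A \<in> Obj C"
  shows "Id C A \<in> Arr C" "Dom C (Id C A) = A" "Cod C (Id C A) = A"
  using Id_Hom[OF assms] by auto

lemma Comp_typing [simp]:
  assumes "f \<in> Arr C" "g \<in> Arr C" "Cod C f = Dom C g"
  shows "f \<cdot> g \<in> Arr C" "Dom C (f \<cdot> g) = Dom C f" "Cod C (f \<cdot> g) = Cod C g"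
  using Comp_Hom[of f "Dom C f" "Dom C g" g "Cod C g"] assms by auto

lemma Id_left [simp]: "f \<in> Arr C \<Longrightarrow> Dom C f = A \<Longrightarrow> Id C A \<cdot> f = f"
  using Id_Comp[of f A "Cod C f"] by simp

lemma Id_right [simp]: "f \<in> Arr C \<Longrightarrow> Cod C f = B \<Longrightarrow> f \<cdot> Id C B = f"
  using Comp_Id[of f "Dom C f" B] by simp

lemma assoc [simp]:
  "f \<in> Arr C \<Longrightarrow> g \<in> Arr C \<Longrightarrow> h \<in> Arr C \<Longrightarrow> Cod C f = Dom C g \<Longrightarrow> Cod C g = Dom C h \<Longrightarrow>
    (f \<cdot> g) \<cdot> h = f \<cdot> (g \<cdot> h)"
  using Comp_assoc[of f "Dom C f" "Dom C g" g "Dom C h" h "Cod C h"] by simp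

text \<open>Since \<open>assoc\<close> nests composites to the right, an equation
  \<open>f \<cdot> g = u\<close> no longer matches inside \<open>f \<cdot> (g \<cdot> k)\<close>;
  this form carries the tail \<open>k\<close> along.\<close>

lemma comp_cong:
  assumes "f \<cdot> g = u" "f \<in> Arr C" "g \<in> Arr C" "k \<in> Arr C" "Cod C f = Dom C g" "Cod C g = Dom C k"
  shows "f \<cdot> (g \<cdot> k) = u \<cdot> k"
  using assms assoc by metis

end

section \<open>Calculus of restrictions\<close>

context restriction_category
begin

lemma Rst_typing [simp]:
  assumes "f \<in> Arr C"
  shows "Rst C f \<in> Arr C" "Dom C (Rst C f) = Dom C f" "Cod C (Rst C f) = Dom C f"
  using Rst_Hom[of f "Dom C f" "Cod C f"] assms by auto

lemma Rst_self [simp]: "f \<in> Arr C \<Longrightarrow> Rst C f \<cdot> f = f"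
  using Rst_Comp[of f "Dom C f" "Cod C f"] by simp

lemma Rst_swap:
  "f \<in> Arr C \<Longrightarrow> g \<in> Arr C \<Longrightarrow> Dom C f = Dom C g \<Longrightarrow> Rst C f \<cdot> Rst C g = Rst C g \<cdot> Rst C f"
  using Rst_commute[of f "Dom C f" "Cod C f" g "Cod C g"] by simp

lemma Rst_of_Rst_Comp:
  "f \<in> Arr C \<Longrightarrow> g \<in> Arr C \<Longrightarrow> Dom C f = Dom C g \<Longrightarrow> Rst C (Rst C g \<cdot> f) = Rst C g \<cdot> Rst C f"
  using Rst_Rst_Comp[of f "Dom C f" "Cod C f" g "Cod C g"] by simp

lemma Comp_Rst_eq:
  "f \<in> Arr C \<Longrightarrow> g \<in> Arr C \<Longrightarrow> Cod C f = Dom C g \<Longrightarrow> f \<cdot> Rst C g = Rst C (f \<cdot> g) \<cdot> f"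
  using Comp_Rst[of f "Dom C f" "Cod C f" g "Cod C g"] by simp

lemma Rst_Id [simp]: "A \<in> Obj C \<Longrightarrow> Rst C (Id C A) = Id C A"
  using Rst_self[of "Id C A"] by simp

lemma Rst_Rst [simp]: "f \<in> Arr C \<Longrightarrow> Rst C (Rst C f) = Rst C f"
  using Rst_of_Rst_Comp[of "Id C (Dom C f)" f] by simp

lemma Rst_Comp_absorb:
  "f \<in> Arr C \<Longrightarrow> g \<in> Arr C \<Longrightarrow> Cod C f = Dom C g \<Longrightarrow> Rst C f \<cdot> Rst C (f \<cdot> g) = Rst C (f \<cdot> g)"
  using Rst_of_Rst_Comp[of "f \<cdot> g" f] comp_cong[OF Rst_self, of f g] by simp

text \<open>Moving \<open>Rst C g\<close> to the front of \<open>f\<close> gives the restriction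
  \<open>Rst C (f \<cdot> g) \<cdot> Rst C f\<close>, whose second factor is absorbed.\<close>

lemma Rst_Comp_Rst:
  assumes "f \<in> Arr C" "g \<in> Arr C" "Cod C f = Dom C g"
  shows "Rst C (f \<cdot> Rst C g) = Rst C (f \<cdot> g)"
proof -
  have "Rst C (f \<cdot> Rst C g) = Rst C (f \<cdot> g) \<cdot> Rst C f"
    using assms by (subst Comp_Rst_eq) (auto simp: Rst_of_Rst_Comp)
  also have "\<dots> = Rst C f \<cdot> Rst C (f \<cdot> g)"
    using assms by (intro Rst_swap) auto
  finally show ?thesis
    using assms by (simp add: Rst_Comp_absorb)
qed

text \<open>The last two hypotheses say \<open>f \<le> g\<close> and \<open>g \<le> f\<close> in the
  restriction order. Taking restrictions shows that each restriction absorbs the other, so they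
  coincide, and then so do the maps.\<close>

lemma le_antisym:
  assumes "f \<in> Arr C" "g \<in> Arr C" "Dom C f = Dom C g" "Rst C f \<cdot> g = f" "Rst C g \<cdot> f = g"
  shows "f = g"
proof -
  have "Rst C f = Rst C f \<cdot> Rst C g"
    using Rst_of_Rst_Comp[of g f] assms by simp
  also have "\<dots> = Rst C g"
    using Rst_of_Rst_Comp[of f g] assms Rst_swap[of f g] by simp
  finally have "Rst C f = Rst C g" .
  then show ?thesis
    using assms by (metis Rst_self)
qed

end

section \<open>Coproducts over lists of objects\<close>

context cocartesian_restriction_category
begin

lemma set_replicate_Obj [simp]: "A \<in> Obj C \<Longrightarrow> set (replicate n A) \<subseteq> Obj C"
  by auto

lemma Dom_image_Obj [simp]: "set fs \<subseteq> Arr C \<Longrightarrow> Dom C ` set fs \<subseteq> Obj C"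
  and Cod_image_Obj [simp]: "set fs \<subseteq> Arr C \<Longrightarrow> Cod C ` set fs \<subseteq> Obj C"
  by auto

lemma Cop_in_Obj [simp]: "set As \<subseteq> Obj C \<Longrightarrow> Cop C As \<in> Obj C"
  by (rule Cop_Obj)

lemma Inj_typing [simp]:
  assumes "set As \<subseteq> Obj C" "j < length As"
  shows "Inj C As j \<in> Arr C" "Dom C (Inj C As j) = As ! j" "Cod C (Inj C As j) = Cop C As"
  using Inj_Hom[OF assms] by auto

lemma Rst_Inj [simp]: "set As \<subseteq> Obj C \<Longrightarrow> j < length As \<Longrightarrow> Rst C (Inj C As j) = Id C (As ! j)"
  using Inj_total[of As j] by (simp add: total_def)

text \<open>Both maps solve the universal problem for the list of composites
  \<open>Inj C As j \<cdot> k\<close>, and its solution is unique.\<close>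

lemma Cop_ext:
  assumes "set As \<subseteq> Obj C" "h \<in> Arr C" "k \<in> Arr C" "Dom C h = Cop C As" "Dom C k = Cop C As"
    "Cod C h = Cod C k" "\<And>j. j < length As \<Longrightarrow> Inj C As j \<cdot> h = Inj C As j \<cdot> k"
  shows "h = k"
proof -
  have "\<exists>!l. l \<in> Hom C (Cop C As) (Cod C k) \<and>
      (\<forall>j<length As. Inj C As j \<cdot> l = map (\<lambda>j. Inj C As j \<cdot> k) [0..<length As] ! j)"
    using assms by (intro Cop_universal) auto
  then show ?thesis
    using assms by auto
qed

lemma copair_spec:
  assumes "set gs \<subseteq> Arr C" "B \<in> Obj C" "\<And>g. g \<in> set gs \<Longrightarrow> Cod C g = B"
  shows "copair C B gs \<in> Hom C (Cop C (map (Dom C) gs)) B \<and>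
    (\<forall>j<length gs. Inj C (map (Dom C) gs) j \<cdot> copair C B gs = gs ! j)"
proof -
  have "gs ! j \<in> Arr C" "Cod C (gs ! j) = B" if "j < length gs" for j
    using assms that nth_mem by blast+
  then have "\<exists>!h. h \<in> Hom C (Cop C (map (Dom C) gs)) B \<and>
      (\<forall>j<length (map (Dom C) gs). Inj C (map (Dom C) gs) j \<cdot> h = gs ! j)"
    using assms by (intro Cop_universal) auto
  from theI'[OF this] show ?thesis
    unfolding copair_def length_map .
qed

lemma copair_typing [simp]:
  assumes "set gs \<subseteq> Arr C" "B \<in> Obj C" "\<forall>g\<in>set gs. Cod C g = B"
  shows "copair C B gs \<in> Arr C" "Dom C (copair C B gs) = Cop C (map (Dom C) gs)"
    "Cod C (copair C B gs) = B"
  using copair_spec[of gs B] assms by auto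

text \<open>The index list is a variable bound by an equation, so that the rule also applies when
  the list is written out, as in \<open>Inj C [X, A] j\<close>.\<close>

lemma Inj_copair [simp]:
  "set gs \<subseteq> Arr C \<Longrightarrow> B \<in> Obj C \<Longrightarrow> \<forall>g\<in>set gs. Cod C g = B \<Longrightarrow> j < length gs \<Longrightarrow>
    As = map (Dom C) gs \<Longrightarrow> Inj C As j \<cdot> copair C B gs = gs ! j"
  using copair_spec[of gs B] by auto

lemma cosum_typing [simp]:
  assumes "set fs \<subseteq> Arr C"
  shows "cosum C fs \<in> Arr C" "Dom C (cosum C fs) = Cop C (map (Dom C) fs)"
    "Cod C (cosum C fs) = Cop C (map (Cod C) fs)"
  and Inj_cosum [simp]: "j < length fs \<Longrightarrow> As = map (Dom C) fs \<Longrightarrow>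
    Inj C As j \<cdot> cosum C fs = fs ! j \<cdot> Inj C (map (Cod C) fs) j"
proof -
  let ?gs = "map (\<lambda>j. fs ! j \<cdot> Inj C (map (Cod C) fs) j) [0..<length fs]"
  have obj: "set (map (Cod C) fs) \<subseteq> Obj C"
    using assms by auto
  have arr: "fs ! j \<in> Arr C" if "j < length fs" for j
    using assms that nth_mem by blast
  have gs: "set ?gs \<subseteq> Arr C" "\<forall>g\<in>set ?gs. Cod C g = Cop C (map (Cod C) fs)"
    using obj arr by auto
  \<comment> \<open>\<open>copair\<close> reads its source off the domains of its entries;
    postcomposing with injections has not changed them.\<close>
  have dom: "map (Dom C) ?gs = map (Dom C) fs"
    using obj arr by (intro nth_equalityI) auto
  note * = copair_typing[OF gs(1) Cop_in_Obj[OF obj] gs(2)]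
  show "cosum C fs \<in> Arr C" "Dom C (cosum C fs) = Cop C (map (Dom C) fs)"
    "Cod C (cosum C fs) = Cop C (map (Cod C) fs)"
    unfolding cosum_def using * dom by simp_all
  show "j < length fs \<Longrightarrow> As = map (Dom C) fs \<Longrightarrow>
    Inj C As j \<cdot> cosum C fs = fs ! j \<cdot> Inj C (map (Cod C) fs) j"
    unfolding cosum_def using Inj_copair[OF gs(1) Cop_in_Obj[OF obj] gs(2), of j As] dom by simp
qed

lemma codiag_typing [simp]:
  assumes "A \<in> Obj C"
  shows "codiag C n A \<in> Arr C" "Dom C (codiag C n A) = Cop C (replicate n A)"
    "Cod C (codiag C n A) = A"
  and Inj_codiag [simp]:
    "j < n \<Longrightarrow> As = replicate n A \<Longrightarrow> Inj C As j \<cdot> codiag C n A = Id C A"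
proof -
  have "set (replicate n (Id C A)) \<subseteq> Arr C" "\<forall>g\<in>set (replicate n (Id C A)). Cod C g = A"
    using assms by auto
  note * = copair_typing[OF this(1) assms this(2)] Inj_copair[OF this(1) assms this(2)]
  show "codiag C n A \<in> Arr C" "Dom C (codiag C n A) = Cop C (replicate n A)"
    "Cod C (codiag C n A) = A"
    "j < n \<Longrightarrow> As = replicate n A \<Longrightarrow> Inj C As j \<cdot> codiag C n A = Id C A"
    using * assms by (simp_all add: codiag_def)
qed

lemma Inj_Rst:
  "set As \<subseteq> Obj C \<Longrightarrow> j < length As \<Longrightarrow> h \<in> Arr C \<Longrightarrow> Dom C h = Cop C As \<Longrightarrow>
    Inj C As j \<cdot> Rst C h = Rst C (Inj C As j \<cdot> h) \<cdot> Inj C As j"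
  by (rule Comp_Rst_eq) auto

text \<open>The codiagonal is total because each injection followed by it is an identity.\<close>

lemma Rst_codiag [simp]:
  assumes "A \<in> Obj C"
  shows "Rst C (codiag C n A) = Id C (Cop C (replicate n A))"
proof (rule Cop_ext[of "replicate n A"])
  fix j assume "j < length (replicate n A)"
  then show "Inj C (replicate n A) j \<cdot> Rst C (codiag C n A) =
      Inj C (replicate n A) j \<cdot> Id C (Cop C (replicate n A))"
    using assms by (simp add: Inj_Rst)
qed (use assms in simp_all)

lemma Inj_copair_Comp [simp]:
  "set gs \<subseteq> Arr C \<Longrightarrow> B \<in> Obj C \<Longrightarrow> \<forall>g\<in>set gs. Cod C g = B \<Longrightarrow> j < length gs \<Longrightarrow>
    As = map (Dom C) gs \<Longrightarrow> k \<in> Arr C \<Longrightarrow> Dom C k = B \<Longrightarrow>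
    Inj C As j \<cdot> (copair C B gs \<cdot> k) = gs ! j \<cdot> k"
  by (rule comp_cong[OF Inj_copair]) auto

lemma Inj_cosum_Comp [simp]:
  assumes "set fs \<subseteq> Arr C" "j < length fs" "As = map (Dom C) fs" "k \<in> Arr C"
    "Dom C k = Cop C (map (Cod C) fs)"
  shows "Inj C As j \<cdot> (cosum C fs \<cdot> k) = fs ! j \<cdot> (Inj C (map (Cod C) fs) j \<cdot> k)"
proof -
  have "fs ! j \<in> Arr C"
    using assms nth_mem by blast
  moreover have "set (map (Cod C) fs) \<subseteq> Obj C" "set (map (Dom C) fs) \<subseteq> Obj C"
    using assms by auto
  ultimately show ?thesis
    using comp_cong[OF Inj_cosum[of fs j As], of k] assms by auto
qed

lemma Inj_codiag_Comp [simp]: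
  assumes "j < n" "As = replicate n A" "k \<in> Arr C" "Dom C k = A"
  shows "Inj C As j \<cdot> (codiag C n A \<cdot> k) = k"
  using comp_cong[OF Inj_codiag[of A j n As], of k] assms by auto

text \<open>Functoriality of sums, checked on each injection.\<close>

lemma cosum_Comp:
  assumes "set fs \<subseteq> Arr C" "set gs \<subseteq> Arr C" "map (Cod C) fs = map (Dom C) gs"
  shows "cosum C fs \<cdot> cosum C gs = cosum C (map (\<lambda>j. fs ! j \<cdot> gs ! j) [0..<length fs])"
    (is "_ = cosum C ?hs")
proof -
  have len: "length fs = length gs"
    using assms(3) map_eq_imp_length_eq by blast
  have arr: "fs ! j \<in> Arr C" "gs ! j \<in> Arr C" "Cod C (fs ! j) = Dom C (gs ! j)"
    if "j < length fs" for j
  proof -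
    show "fs ! j \<in> Arr C" "gs ! j \<in> Arr C"
      using assms(1,2) that len by (metis nth_mem subsetD)+
    show "Cod C (fs ! j) = Dom C (gs ! j)"
      using assms(3) that len by (metis nth_map)
  qed
  have hs: "set ?hs \<subseteq> Arr C"
    using arr by auto
  have dom: "map (Dom C) ?hs = map (Dom C) fs" and cod: "map (Cod C) ?hs = map (Cod C) gs"
    using arr len by (auto intro!: nth_equalityI)
  note t = cosum_typing[OF hs, unfolded dom cod]
  show ?thesis
  proof (rule Cop_ext[of "map (Dom C) fs"])
    fix j assume "j < length (map (Dom C) fs)"
    then show "Inj C (map (Dom C) fs) j \<cdot> (cosum C fs \<cdot> cosum C gs) =
        Inj C (map (Dom C) fs) j \<cdot> cosum C ?hs"
      using assms len arr Inj_cosum[OF hs, of j, unfolded dom cod] by simp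
  qed (use assms t in simp_all)
qed

lemma Inj_list_typing:
  assumes "set Bs \<subseteq> Obj C"
  shows "set (map (Inj C Bs) [0..<length Bs]) \<subseteq> Arr C"
    "map (Dom C) (map (Inj C Bs) [0..<length Bs]) = Bs"
    "map (Cod C) (map (Inj C Bs) [0..<length Bs]) = replicate (length Bs) (Cop C Bs)"
  using assms by (auto intro!: nth_equalityI)

text \<open>The second index is written \<open>Suc 0\<close>, the form into which the simplifier
  brings the index 1.\<close>

lemma Cop_ext2:
  assumes "X \<in> Obj C" "Y \<in> Obj C" "h \<in> Arr C" "k \<in> Arr C" "Dom C h = Cop C [X, Y]"
    "Dom C k = Cop C [X, Y]" "Cod C h = Cod C k" "Inj C [X, Y] 0 \<cdot> h = Inj C [X, Y] 0 \<cdot> k"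
    "Inj C [X, Y] (Suc 0) \<cdot> h = Inj C [X, Y] (Suc 0) \<cdot> k"
  shows "h = k"
  using assms by (intro Cop_ext[of "[X, Y]" h k]) (auto simp: less_Suc_eq)

lemma Cop_ext3:
  assumes "X \<in> Obj C" "Y \<in> Obj C" "Z \<in> Obj C" "h \<in> Arr C" "k \<in> Arr C"
    "Dom C h = Cop C [X, Y, Z]" "Dom C k = Cop C [X, Y, Z]" "Cod C h = Cod C k"
    "Inj C [X, Y, Z] 0 \<cdot> h = Inj C [X, Y, Z] 0 \<cdot> k"
    "Inj C [X, Y, Z] (Suc 0) \<cdot> h = Inj C [X, Y, Z] (Suc 0) \<cdot> k"
    "Inj C [X, Y, Z] (Suc (Suc 0)) \<cdot> h = Inj C [X, Y, Z] (Suc (Suc 0)) \<cdot> k"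
  shows "h = k"
  using assms by (intro Cop_ext[of "[X, Y, Z]" h k]) (auto simp: less_Suc_eq)

lemma assoc_right_typing [simp]:
  assumes "X \<in> Obj C" "Y \<in> Obj C" "Z \<in> Obj C"
  shows "assoc_right C X Y Z \<in> Arr C" "Dom C (assoc_right C X Y Z) = Cop C [X, Y, Z]"
    "Cod C (assoc_right C X Y Z) = Cop C [X, Cop C [Y, Z]]"
  using assms by (auto simp: assoc_right_def)

lemma assoc_left_typing [simp]:
  assumes "X \<in> Obj C" "Y \<in> Obj C" "Z \<in> Obj C"
  shows "assoc_left C X Y Z \<in> Arr C" "Dom C (assoc_left C X Y Z) = Cop C [X, Y, Z]"
    "Cod C (assoc_left C X Y Z) = Cop C [Cop C [X, Y], Z]"
  using assms by (auto simp: assoc_left_def)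

end

section \<open>Restriction zeroes and quasi-projections\<close>

context extensive_restriction_category
begin

lemma Zero_typing [simp]:
  assumes "A \<in> Obj C" "B \<in> Obj C"
  shows "Zero C A B \<in> Arr C" "Dom C (Zero C A B) = A" "Cod C (Zero C A B) = B"
  using Zero_Hom[OF assms] by auto

lemma Zero_right [simp]:
  "f \<in> Arr C \<Longrightarrow> Cod C f = B \<Longrightarrow> D \<in> Obj C \<Longrightarrow> f \<cdot> Zero C B D = Zero C (Dom C f) D"
  using Comp_Zero[of f "Dom C f" B D] by simp

lemma Zero_left [simp]:
  "f \<in> Arr C \<Longrightarrow> Dom C f = B \<Longrightarrow> D \<in> Obj C \<Longrightarrow> Zero C D B \<cdot> f = Zero C D (Cod C f)"
  using Zero_Comp[of f B "Cod C f" D] by simp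

declare Rst_Zero [simp]

lemma quasi_proj_spec:
  assumes "set As \<subseteq> Obj C" "j < length As"
  shows "quasi_proj C As j \<in> Hom C (Cop C As) (As ! j) \<and>
    Inj C As j \<cdot> quasi_proj C As j = Id C (As ! j) \<and>
    (\<forall>i<length As. i \<noteq> j \<longrightarrow> Inj C As i \<cdot> quasi_proj C As j = Zero C (As ! i) (As ! j))"
proof -
  \<comment> \<open>The copairing of an identity in place \<open>j\<close> and zeroes elsewhere is
    the quasi-projection.\<close>
  let ?gs = "map (\<lambda>i. if i = j then Id C (As ! j) else Zero C (As ! i) (As ! j)) [0..<length As]"
  have obj: "As ! i \<in> Obj C" if "i < length As" for i
    using assms that nth_mem by blast
  have "\<exists>!p. p \<in> Hom C (Cop C As) (As ! j) \<and> (\<forall>i<length As. Inj C As i \<cdot> p = ?gs ! i)"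
    using assms obj by (intro Cop_universal) auto
  \<comment> \<open>Splitting off the case \<open>i = j\<close> gives an equal predicate on
    \<open>p\<close>, so unique existence transfers.\<close>
  then have "\<exists>!p. p \<in> Hom C (Cop C As) (As ! j) \<and> Inj C As j \<cdot> p = Id C (As ! j) \<and>
     (\<forall>i<length As. i \<noteq> j \<longrightarrow> Inj C As i \<cdot> p = Zero C (As ! i) (As ! j))"
    by (rule back_subst[of Ex1]) (use assms(2) in \<open>auto intro!: ext\<close>)
  then show ?thesis
    unfolding quasi_proj_def by (rule theI')
qed

lemma quasi_proj_typing [simp]:
  assumes "set As \<subseteq> Obj C" "j < length As"
  shows "quasi_proj C As j \<in> Arr C" "Dom C (quasi_proj C As j) = Cop C As"
    "Cod C (quasi_proj C As j) = As ! j"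
  using quasi_proj_spec[OF assms] by auto

lemma Inj_quasi_proj [simp]:
  "set As \<subseteq> Obj C \<Longrightarrow> i < length As \<Longrightarrow> j < length As \<Longrightarrow>
    Inj C As i \<cdot> quasi_proj C As j = (if i = j then Id C (As ! i) else Zero C (As ! i) (As ! j))"
  using quasi_proj_spec[of As j] by auto

lemma Inj_quasi_proj_Comp [simp]:
  assumes "set As \<subseteq> Obj C" "i < length As" "j < length As" "k \<in> Arr C" "Dom C k = As ! j"
  shows "Inj C As i \<cdot> (quasi_proj C As j \<cdot> k) = (if i = j then k else Zero C (As ! i) (Cod C k))"
proof -
  have "As ! i \<in> Obj C"
    using assms nth_mem by blast
  then show ?thesis
    using comp_cong[OF Inj_quasi_proj[of As i j], of k] assms by auto
qed

text \<open>After the injection \<open>j\<close> both sides are that injection; after any other one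
  both are zero. Thus a quasi-projection is a partial inverse of its injection.\<close>

lemma quasi_proj_Inj:
  assumes "set As \<subseteq> Obj C" "j < length As"
  shows "quasi_proj C As j \<cdot> Inj C As j = Rst C (quasi_proj C As j)"
proof (rule Cop_ext[of As])
  fix i assume i: "i < length As"
  then have "As ! i \<in> Obj C" "As ! j \<in> Obj C"
    using assms nth_mem by blast+
  then show "Inj C As i \<cdot> (quasi_proj C As j \<cdot> Inj C As j) =
      Inj C As i \<cdot> Rst C (quasi_proj C As j)"
    using assms i by (auto simp: Inj_Rst)
qed (use assms in auto)

text \<open>Naturality of the quasi-projections: injections of index other than \<open>j\<close>
  send both sides to zero. It is the rule that computes components after postcomposing with a
  sum.\<close>

lemma cosum_quasi_proj:
  assumes "set fs \<subseteq> Arr C" "j < length fs" "As = map (Cod C) fs"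
  shows "cosum C fs \<cdot> quasi_proj C As j = quasi_proj C (map (Dom C) fs) j \<cdot> fs ! j"
proof (rule Cop_ext[of "map (Dom C) fs"])
  have obj: "set (map (Cod C) fs) \<subseteq> Obj C" "set (map (Dom C) fs) \<subseteq> Obj C"
    using assms by auto
  have arr: "fs ! i \<in> Arr C" if "i < length fs" for i
    using assms that nth_mem by blast
  show "set (map (Dom C) fs) \<subseteq> Obj C" by fact
  show "cosum C fs \<cdot> quasi_proj C As j \<in> Arr C"
    "quasi_proj C (map (Dom C) fs) j \<cdot> fs ! j \<in> Arr C"
    "Dom C (cosum C fs \<cdot> quasi_proj C As j) = Cop C (map (Dom C) fs)"
    "Dom C (quasi_proj C (map (Dom C) fs) j \<cdot> fs ! j) = Cop C (map (Dom C) fs)"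
    "Cod C (cosum C fs \<cdot> quasi_proj C As j) = Cod C (quasi_proj C (map (Dom C) fs) j \<cdot> fs ! j)"
    using assms obj arr by auto
  fix i assume "i < length (map (Dom C) fs)"
  then show "Inj C (map (Dom C) fs) i \<cdot> (cosum C fs \<cdot> quasi_proj C As j) =
    Inj C (map (Dom C) fs) i \<cdot> (quasi_proj C (map (Dom C) fs) j \<cdot> fs ! j)"
    using assms obj arr by auto
qed

subsection \<open>Joint monicity of the quasi-projections\<close>

lemma is_bracketD:
  assumes "is_bracket C Bs h d"
  shows "d \<in> Arr C" "Dom C d = Dom C h" "Cod C d = Cop C (replicate (length Bs) (Dom C h))"
    "d \<cdot> codiag C (length Bs) (Dom C h) = Rst C h"
    "d \<cdot> cosum C (replicate (length Bs) h) = h \<cdot> cosum C (map (Inj C Bs) [0..<length Bs])"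
  using assms by (auto simp: is_bracket_def)

lemma quasi_proj_list_typing:
  assumes "set Bs \<subseteq> Obj C"
  shows "set (map (quasi_proj C Bs) [0..<length Bs]) \<subseteq> Arr C"
    "map (Cod C) (map (quasi_proj C Bs) [0..<length Bs]) = Bs"
    "map (Dom C) (map (quasi_proj C Bs) [0..<length Bs]) = replicate (length Bs) (Cop C Bs)"
  using assms by (auto intro!: nth_equalityI)

text \<open>On the summand \<open>j\<close> the composite is an injection, its quasi-projection and
  the injection again. This cancels the sum of injections in the second equation of a
  bracket.\<close>

lemma cosum_Inj_cosum_quasi_proj:
  assumes "set Bs \<subseteq> Obj C"
  shows "cosum C (map (Inj C Bs) [0..<length Bs]) \<cdot> cosum C (map (quasi_proj C Bs) [0..<length Bs]) =
    Id C (Cop C Bs)"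
proof (rule Cop_ext[OF assms])
  note i = Inj_list_typing[OF assms] and q = quasi_proj_list_typing[OF assms]
  note ti = cosum_typing[OF i(1), unfolded i(2,3)] and tq = cosum_typing[OF q(1), unfolded q(2,3)]
  show "cosum C (map (Inj C Bs) [0..<length Bs]) \<cdot> cosum C (map (quasi_proj C Bs) [0..<length Bs])
      \<in> Arr C"
    "Dom C (cosum C (map (Inj C Bs) [0..<length Bs]) \<cdot>
      cosum C (map (quasi_proj C Bs) [0..<length Bs])) = Cop C Bs"
    "Cod C (cosum C (map (Inj C Bs) [0..<length Bs]) \<cdot>
      cosum C (map (quasi_proj C Bs) [0..<length Bs])) = Cod C (Id C (Cop C Bs))"
    using ti tq assms by simp_all
  fix j assume j: "j < length Bs"
  then have obj: "Bs ! j \<in> Obj C"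
    using assms nth_mem by blast
  have "Inj C Bs j \<cdot> (cosum C (map (Inj C Bs) [0..<length Bs]) \<cdot>
      cosum C (map (quasi_proj C Bs) [0..<length Bs])) =
    Inj C Bs j \<cdot> (Inj C (replicate (length Bs) (Cop C Bs)) j \<cdot>
      cosum C (map (quasi_proj C Bs) [0..<length Bs]))"
    using Inj_cosum_Comp[OF i(1), of j Bs, unfolded i(2,3)] tq j by simp
  also have "\<dots> = Inj C Bs j \<cdot> (quasi_proj C Bs j \<cdot> Inj C Bs j)"
    using Inj_cosum[OF q(1), of j "replicate (length Bs) (Cop C Bs)", unfolded q(2,3)] j by simp
  also have "\<dots> = Inj C Bs j \<cdot> Id C (Cop C Bs)"
    using j assms obj by simp
  finally show "Inj C Bs j \<cdot> (cosum C (map (Inj C Bs) [0..<length Bs]) \<cdot>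
      cosum C (map (quasi_proj C Bs) [0..<length Bs])) = Inj C Bs j \<cdot> Id C (Cop C Bs)" .
qed (use assms in simp_all)

lemma bracket_cosum_components:
  assumes "set Bs \<subseteq> Obj C" "h \<in> Hom C A (Cop C Bs)" "is_bracket C Bs h d"
  shows "d \<cdot> cosum C (map (\<lambda>j. h \<cdot> quasi_proj C Bs j) [0..<length Bs]) = h"
proof -
  note d = is_bracketD[OF assms(3)]
  note i = Inj_list_typing[OF assms(1)] and q = quasi_proj_list_typing[OF assms(1)]
  note ti = cosum_typing[OF i(1), unfolded i(2,3)] and tq = cosum_typing[OF q(1), unfolded q(2,3)]
  have r: "set (replicate (length Bs) h) \<subseteq> Arr C"
    using assms(2) by auto
  have "cosum C (map (\<lambda>j. h \<cdot> quasi_proj C Bs j) [0..<length Bs]) =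
      cosum C (replicate (length Bs) h) \<cdot> cosum C (map (quasi_proj C Bs) [0..<length Bs])"
    using assms q(3) by (subst cosum_Comp[OF r q(1)]) (auto intro!: arg_cong[where f = "cosum C"])
  then have "d \<cdot> cosum C (map (\<lambda>j. h \<cdot> quasi_proj C Bs j) [0..<length Bs]) =
      (d \<cdot> cosum C (replicate (length Bs) h)) \<cdot> cosum C (map (quasi_proj C Bs) [0..<length Bs])"
    using d(1-3) tq assms cosum_typing[OF r] by simp
  also have "\<dots> = h \<cdot> (cosum C (map (Inj C Bs) [0..<length Bs]) \<cdot>
      cosum C (map (quasi_proj C Bs) [0..<length Bs]))"
    unfolding d(5) using assms ti tq by simp
  finally show ?thesis
    using assms by (simp add: cosum_Inj_cosum_quasi_proj)
qed

text \<open>For a bracket \<open>d\<close> of \<open>h\<close> and the sum \<open>c\<close> of the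
  components of \<open>h\<close>, \<open>Rst C h \<cdot> k\<close> is \<open>d\<close> followed by
  \<open>Rst C c\<close>, the codiagonal and \<open>k\<close>. On the copy \<open>j\<close> of
  \<open>A\<close>, what follows \<open>d\<close> is \<open>k\<close> restricted to the component
  \<open>j\<close>, so comparing \<open>f\<close> and \<open>g\<close> there suffices.\<close>

lemma Rst_component_cover:
  assumes "set Bs \<subseteq> Obj C" "h \<in> Hom C A (Cop C Bs)" "f \<in> Hom C A D" "g \<in> Hom C A D"
    and eq: "\<And>j. j < length Bs \<Longrightarrow>
      Rst C (h \<cdot> quasi_proj C Bs j) \<cdot> f = Rst C (h \<cdot> quasi_proj C Bs j) \<cdot> g"
  shows "Rst C h \<cdot> f = Rst C h \<cdot> g"
proof -
  obtain d where br: "is_bracket C Bs h d"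
    using ex_bracket[OF assms(1,2)] by blast
  note d = is_bracketD[OF br]
  let ?n = "length Bs"
  let ?ks = "map (\<lambda>j. h \<cdot> quasi_proj C Bs j) [0..<?n]"
  let ?c = "cosum C ?ks"
  let ?D = "codiag C ?n A"
  have A: "A \<in> Obj C" "h \<in> Arr C" "Dom C h = A" "Cod C h = Cop C Bs"
    using assms by auto
  have ks: "set ?ks \<subseteq> Arr C"
    and dom: "map (Dom C) ?ks = replicate ?n A" and cod: "map (Cod C) ?ks = Bs"
    using assms(1) A by (auto intro!: nth_equalityI)
  note c = cosum_typing[OF ks, unfolded dom cod]
  \<comment> \<open>As the codiagonal is total, \<open>d\<close> has the same restriction as
    \<open>d \<cdot> ?D\<close>, which is \<open>Rst C h\<close>.\<close>
  have "Rst C d = Rst C (d \<cdot> Rst C ?D)"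
    using d A by simp
  also have "\<dots> = Rst C (d \<cdot> ?D)"
    using d A by (intro Rst_Comp_Rst) auto
  also have "\<dots> = Rst C h"
    using d(4) A by simp
  finally have Rd: "Rst C d = Rst C h" .
  \<comment> \<open>Since \<open>d \<cdot> ?c\<close> is \<open>h\<close>, the restriction moved to
    the front is that of \<open>d\<close> itself.\<close>
  have "d \<cdot> Rst C ?c = Rst C (d \<cdot> ?c) \<cdot> d"
    using d c A by (intro Comp_Rst_eq) auto
  also have "\<dots> = Rst C d \<cdot> d"
    using bracket_cosum_components[OF assms(1,2) br] Rd by simp
  finally have dc: "d \<cdot> Rst C ?c = d"
    using d by simp
  have key: "Rst C ?c \<cdot> (?D \<cdot> f) = Rst C ?c \<cdot> (?D \<cdot> g)"
  proof (rule Cop_ext[of "replicate ?n A"])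
    fix j assume "j < length (replicate ?n A)"
    then have j: "j < ?n" by simp
    have comp: "Inj C (replicate ?n A) j \<cdot> (Rst C ?c \<cdot> (?D \<cdot> k)) =
        Rst C (h \<cdot> quasi_proj C Bs j) \<cdot> k" if "k \<in> Hom C A D" for k
    proof -
      have "Inj C (replicate ?n A) j \<cdot> Rst C ?c =
          Rst C (Inj C (replicate ?n A) j \<cdot> ?c) \<cdot> Inj C (replicate ?n A) j"
        using c A j by (intro Inj_Rst) auto
      also have "Inj C (replicate ?n A) j \<cdot> ?c = (h \<cdot> quasi_proj C Bs j) \<cdot> Inj C Bs j"
        using Inj_cosum[OF ks, of j "replicate ?n A", unfolded dom cod] j by simp
      also have "Rst C \<dots> = Rst C ((h \<cdot> quasi_proj C Bs j) \<cdot> Rst C (Inj C Bs j))"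
        using A assms(1) j by (intro Rst_Comp_Rst[symmetric]) auto
      also have "\<dots> = Rst C (h \<cdot> quasi_proj C Bs j)"
        using A assms(1) j by simp
      finally have "Inj C (replicate ?n A) j \<cdot> Rst C ?c =
          Rst C (h \<cdot> quasi_proj C Bs j) \<cdot> Inj C (replicate ?n A) j" .
      from comp_cong[OF this, of "?D \<cdot> k"] show ?thesis
        using that A c j assms(1) by simp
    qed
    show "Inj C (replicate ?n A) j \<cdot> (Rst C ?c \<cdot> (?D \<cdot> f)) =
        Inj C (replicate ?n A) j \<cdot> (Rst C ?c \<cdot> (?D \<cdot> g))"
      using comp[OF assms(3)] comp[OF assms(4)] eq[OF j] by simp
  qed (use A c assms in simp_all)
  have "Rst C h \<cdot> k = d \<cdot> (Rst C ?c \<cdot> (?D \<cdot> k))" if "k \<in> Hom C A D" for k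
  proof -
    have "d \<cdot> (Rst C ?c \<cdot> (?D \<cdot> k)) = d \<cdot> (?D \<cdot> k)"
      using comp_cong[OF dc, of "?D \<cdot> k"] d c A that by simp
    also have "\<dots> = Rst C h \<cdot> k"
      using comp_cong[OF d(4), of k] d A that by simp
    finally show ?thesis ..
  qed
  then show ?thesis
    using key assms by metis
qed

text \<open>Both sides are the part of \<open>h\<close> that lands in the summand \<open>j\<close>;
  the right-hand side mentions \<open>h\<close> only through its component.\<close>

lemma Rst_component_Comp:
  assumes "set Bs \<subseteq> Obj C" "h \<in> Hom C A (Cop C Bs)" "j < length Bs"
  shows "Rst C (h \<cdot> quasi_proj C Bs j) \<cdot> h = h \<cdot> quasi_proj C Bs j \<cdot> Inj C Bs j"
  using assms Comp_Rst_eq[of h "quasi_proj C Bs j"] by (simp add: quasi_proj_Inj)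

text \<open>By \<open>Rst_component_Comp\<close>, maps with equal components agree on the
  restriction of each component. The covering lemma, used in both directions, makes each map lie
  below the other.\<close>

lemma quasi_proj_jointly_monic:
  assumes "set Bs \<subseteq> Obj C" "h \<in> Hom C A (Cop C Bs)" "k \<in> Hom C A (Cop C Bs)"
    and "\<And>j. j < length Bs \<Longrightarrow> h \<cdot> quasi_proj C Bs j = k \<cdot> quasi_proj C Bs j"
  shows "h = k"
proof (rule le_antisym)
  have eq: "Rst C (h \<cdot> quasi_proj C Bs j) \<cdot> h = Rst C (h \<cdot> quasi_proj C Bs j) \<cdot> k"
    if "j < length Bs" for j
    using Rst_component_Comp[OF assms(1,2) that] Rst_component_Comp[OF assms(1,3) that]
      assms(4)[OF that] by simp
  from Rst_component_cover[OF assms(1,2,3,2) eq[symmetric]] show "Rst C h \<cdot> k = h"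
    using assms(2) by simp
  from Rst_component_cover[OF assms(1,3,2,3)] eq show "Rst C k \<cdot> h = k"
    using assms by simp
qed (use assms in auto)

text \<open>The first bracket equation makes the component of \<open>d\<close> a restriction
  idempotent below \<open>Rst C h\<close>. The second shows that it cuts \<open>h\<close> down to
  the part landing in the summand \<open>j\<close>; comparing restrictions identifies the
  two.\<close>

lemma bracket_component:
  assumes "set Bs \<subseteq> Obj C" "h \<in> Hom C A (Cop C Bs)" "is_bracket C Bs h d" "j < length Bs"
  shows "d \<cdot> quasi_proj C (replicate (length Bs) A) j = Rst C (h \<cdot> quasi_proj C Bs j)"
proof -
  note d = is_bracketD[OF assms(3)]
  let ?n = "length Bs"
  let ?q = "quasi_proj C (replicate ?n A) j"
  let ?p = "quasi_proj C Bs j"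
  let ?D = "codiag C ?n A"
  have A: "A \<in> Obj C" "h \<in> Arr C" "Dom C h = A" "Cod C h = Cop C Bs"
    using assms by auto
  have dt: "d \<in> Arr C" "Dom C d = A" "Cod C d = Cop C (replicate ?n A)"
    using d(1-3) A by auto
  have q: "?q \<in> Arr C" "Dom C ?q = Cop C (replicate ?n A)" "Cod C ?q = A"
    using A assms(4) by simp_all
  have p: "?p \<in> Arr C" "Dom C ?p = Cop C Bs" "Cod C ?p = Bs ! j"
    using assms(1,4) by simp_all
  \<comment> \<open>\<open>Rst C ?q\<close> is \<open>?q\<close> followed by the injection
    \<open>j\<close>, which the codiagonal undoes.\<close>
  have "Rst C ?q \<cdot> ?D = ?q"
    using A assms(4) by (simp flip: quasi_proj_Inj)
  then have "d \<cdot> ?q = (d \<cdot> Rst C ?q) \<cdot> ?D"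
    using dt q A by simp
  also have "d \<cdot> Rst C ?q = Rst C (d \<cdot> ?q) \<cdot> d"
    using dt q by (intro Comp_Rst_eq) auto
  also have "Rst C (d \<cdot> ?q) \<cdot> d \<cdot> ?D = Rst C (d \<cdot> ?q) \<cdot> Rst C h"
    using dt q A d(4) by simp
  finally have e: "d \<cdot> ?q = Rst C (d \<cdot> ?q) \<cdot> Rst C h" .
  have "Rst C (d \<cdot> ?q) = Rst C (Rst C (d \<cdot> ?q) \<cdot> Rst C h)"
    using e by simp
  also have "\<dots> = Rst C (d \<cdot> ?q) \<cdot> Rst C h"
    using dt q A by (subst Rst_of_Rst_Comp) auto
  finally have e': "Rst C (d \<cdot> ?q) = d \<cdot> ?q"
    using e by simp
  have r: "set (replicate ?n h) \<subseteq> Arr C"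
    using A by auto
  note i = Inj_list_typing[OF assms(1)]
  note ti = cosum_typing[OF i(1), unfolded i(2,3)]
  let ?Q = "quasi_proj C (replicate ?n (Cop C Bs)) j"
  have Q: "?Q \<in> Arr C" "Dom C ?Q = Cop C (replicate ?n (Cop C Bs))" "Cod C ?Q = Cop C Bs"
    using assms(1,4) by simp_all
  \<comment> \<open>The second bracket equation is projected onto the copy \<open>j\<close> of
    \<open>Cop C Bs\<close>; naturality of quasi-projections evaluates both sides.\<close>
  have "(d \<cdot> ?q) \<cdot> h = (d \<cdot> cosum C (replicate ?n h)) \<cdot> ?Q"
    using cosum_quasi_proj[OF r, of j "replicate ?n (Cop C Bs)"] dt q Q A assms(4) r by simp
  also have "\<dots> = h \<cdot> (?p \<cdot> Inj C Bs j)"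
    unfolding d(5) using cosum_quasi_proj[OF i(1), of j "replicate ?n (Cop C Bs)", unfolded i(2,3)]
      ti Q A assms(1,4) by simp
  also have "\<dots> = Rst C (h \<cdot> ?p) \<cdot> h"
    using Rst_component_Comp[OF assms(1,2,4)] A p assms(1,4) by simp
  finally have "Rst C ((d \<cdot> ?q) \<cdot> h) = Rst C (Rst C (h \<cdot> ?p) \<cdot> h)"
    by simp
  moreover have "Rst C ((d \<cdot> ?q) \<cdot> h) = d \<cdot> ?q"
  proof -
    have "Rst C ((d \<cdot> ?q) \<cdot> h) = Rst C (Rst C (d \<cdot> ?q) \<cdot> h)"
      using e' by simp
    also have "\<dots> = Rst C (d \<cdot> ?q) \<cdot> Rst C h"
      using dt q A by (intro Rst_of_Rst_Comp) auto
    finally show ?thesis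
      using e by simp
  qed
  moreover have "Rst C (Rst C (h \<cdot> ?p) \<cdot> h) = Rst C (h \<cdot> ?p)"
  proof -
    have "Rst C (Rst C (h \<cdot> ?p) \<cdot> h) = Rst C (h \<cdot> ?p) \<cdot> Rst C h"
      using p A by (intro Rst_of_Rst_Comp) auto
    also have "\<dots> = Rst C h \<cdot> Rst C (h \<cdot> ?p)"
      using p A by (intro Rst_swap) auto
    finally show ?thesis
      using p A by (simp add: Rst_Comp_absorb)
  qed
  ultimately show ?thesis by simp
qed

lemma is_bracket_unique:
  assumes "set Bs \<subseteq> Obj C" "h \<in> Hom C A (Cop C Bs)" "is_bracket C Bs h d" "is_bracket C Bs h d'"
  shows "d = d'"
proof (rule quasi_proj_jointly_monic)
  show "d \<in> Hom C A (Cop C (replicate (length Bs) A))"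
    "d' \<in> Hom C A (Cop C (replicate (length Bs) A))"
    using is_bracketD[OF assms(3)] is_bracketD[OF assms(4)] assms(2) by auto
qed (use assms bracket_component in auto)

lemma is_bracket_bracket:
  assumes "set Bs \<subseteq> Obj C" "h \<in> Hom C A (Cop C Bs)"
  shows "is_bracket C Bs h (bracket C Bs h)"
  unfolding bracket_def using ex_bracket[OF assms] is_bracket_unique[OF assms] by (blast intro: theI)

text \<open>The components of the bracket of \<open>d\<close> are the restrictions of those of
  \<open>d\<close>, so by joint monicity \<open>d\<close> is its own bracket exactly when each
  component equals its restriction.\<close>

lemma decision_iff:
  assumes "d \<in> Hom C A (Cop C (replicate n A))"
  shows "decision C n A d \<longleftrightarrow> (\<forall>j<n. Rst C (d \<cdot> quasi_proj C (replicate n A) j) =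
    d \<cdot> quasi_proj C (replicate n A) j)"
proof -
  have obj: "set (replicate n A) \<subseteq> Obj C"
    using assms by auto
  note br = is_bracket_bracket[OF obj assms]
  have t: "bracket C (replicate n A) d \<in> Hom C A (Cop C (replicate n A))"
    using is_bracketD[OF br] assms by simp
  have comp: "bracket C (replicate n A) d \<cdot> quasi_proj C (replicate n A) j =
      Rst C (d \<cdot> quasi_proj C (replicate n A) j)" if "j < n" for j
    using bracket_component[OF obj assms br, of j] that by simp
  show ?thesis
    using quasi_proj_jointly_monic[OF obj t assms] comp assms unfolding decision_def by auto
qed

subsection \<open>Rows and decision disjoint families\<close>

text \<open>By naturality the component \<open>j\<close> of the row is
  \<open>Rst C (fs ! j) \<cdot> fs ! j\<close>.\<close>

lemma family_decision_Comp_cosum: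
  assumes "A \<in> Obj C" "\<forall>f\<in>set fs. f \<in> Arr C \<and> Dom C f = A" "is_family_decision C A fs d"
  shows "d \<cdot> cosum C fs \<in> Hom C A (Cop C (map (Cod C) fs))"
    and "j < length fs \<Longrightarrow> d \<cdot> cosum C fs \<cdot> quasi_proj C (map (Cod C) fs) j = fs ! j"
proof -
  have fs: "set fs \<subseteq> Arr C" and dom: "map (Dom C) fs = replicate (length fs) A"
    using assms(2) by (auto intro!: nth_equalityI)
  have d: "d \<in> Hom C A (Cop C (replicate (length fs) A))"
    using assms(3) by (simp add: is_family_decision_def decision_def)
  show "d \<cdot> cosum C fs \<in> Hom C A (Cop C (map (Cod C) fs))"
    using d fs dom by simp
  assume j: "j < length fs"
  then have fj: "fs ! j \<in> Arr C" "Dom C (fs ! j) = A"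
    using assms(2) nth_mem by blast+
  have "d \<cdot> cosum C fs \<cdot> quasi_proj C (map (Cod C) fs) j =
      d \<cdot> quasi_proj C (replicate (length fs) A) j \<cdot> fs ! j"
    using d fs dom j fj assms(1) by (simp add: cosum_quasi_proj)
  also have "\<dots> = fs ! j"
    using assms(3) j fj by (simp add: is_family_decision_def)
  finally show "d \<cdot> cosum C fs \<cdot> quasi_proj C (map (Cod C) fs) j = fs ! j" .
qed

text \<open>The bracket of \<open>h\<close> is a decision whose components are the restrictions of
  the entries of \<open>fs\<close>. The row it yields has the same components as
  \<open>h\<close>.\<close>

lemma row_eqI:
  assumes "A \<in> Obj C" "\<forall>f\<in>set fs. f \<in> Arr C \<and> Dom C f = A"
    and h: "h \<in> Hom C A (Cop C (map (Cod C) fs))"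
    and comp: "\<And>j. j < length fs \<Longrightarrow> h \<cdot> quasi_proj C (map (Cod C) fs) j = fs ! j"
  shows "decision_disjoint C A fs" "row C A fs = h"
proof -
  let ?Bs = "map (Cod C) fs" and ?As = "replicate (length fs) A"
  have obj: "set ?Bs \<subseteq> Obj C" "set ?As \<subseteq> Obj C"
    using assms(1,2) by auto
  let ?d = "bracket C ?Bs h"
  note br = is_bracket_bracket[OF obj(1) h]
  have d: "?d \<in> Hom C A (Cop C ?As)"
    using is_bracketD[OF br] h by simp
  have dc: "?d \<cdot> quasi_proj C ?As j = Rst C (fs ! j)" if "j < length fs" for j
    using bracket_component[OF obj(1) h br, of j] that comp by simp
  have fd: "is_family_decision C A fs ?d"
    unfolding is_family_decision_def decision_iff[OF d] using dc assms(2) by auto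
  then show "decision_disjoint C A fs"
    using assms(2) unfolding decision_disjoint_def by blast
  \<comment> \<open>Joint monicity makes the decision unique, which the description operator in
    \<open>family_decision\<close> requires.\<close>
  have "d' = ?d" if "is_family_decision C A fs d'" for d'
    using that dc by (intro quasi_proj_jointly_monic[OF obj(2) _ d])
      (auto simp: is_family_decision_def decision_def)
  then have eq: "family_decision C A fs = ?d"
    unfolding family_decision_def using fd by (intro the_equality)
  show "row C A fs = h"
    unfolding row_def eq
    using family_decision_Comp_cosum[OF assms(1,2) fd] comp
    by (intro quasi_proj_jointly_monic[OF obj(1) _ h]) auto
qed

lemma decision_disjointE:
  assumes "A \<in> Obj C" "decision_disjoint C A fs"
  obtains h where "h \<in> Hom C A (Cop C (map (Cod C) fs))"
    "\<forall>j<length fs. h \<cdot> quasi_proj C (map (Cod C) fs) j = fs ! j"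
proof -
  have fs: "\<forall>f\<in>set fs. f \<in> Arr C \<and> Dom C f = A"
    using assms(2) by (auto simp: decision_disjoint_def)
  obtain d where "is_family_decision C A fs d"
    using assms(2) by (auto simp: decision_disjoint_def)
  from family_decision_Comp_cosum[OF assms(1) fs this] that show thesis
    by blast
qed

lemma perpE:
  assumes "f \<in> Hom C A B" "g \<in> Hom C A D" "perp C f g"
  obtains h where "h \<in> Hom C A (Cop C [B, D])"
    "h \<cdot> quasi_proj C [B, D] 0 = f" "h \<cdot> quasi_proj C [B, D] (Suc 0) = g"
proof -
  have "A \<in> Obj C" "decision_disjoint C A [f, g]"
    using assms by (auto simp: perp_def)
  then obtain h where "h \<in> Hom C A (Cop C (map (Cod C) [f, g]))"
    "\<forall>j<length [f, g]. h \<cdot> quasi_proj C (map (Cod C) [f, g]) j = [f, g] ! j"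
    by (rule decision_disjointE)
  then show thesis
    using assms that by auto
qed

lemma pair_row:
  assumes "h \<in> Hom C A (Cop C [B, D])" "B \<in> Obj C" "D \<in> Obj C"
    "h \<cdot> quasi_proj C [B, D] 0 = f" "h \<cdot> quasi_proj C [B, D] (Suc 0) = g"
  shows "perp C f g" "row C A [f, g] = h"
    and "f \<in> Hom C A B" "g \<in> Hom C A D"
proof -
  show f: "f \<in> Hom C A B" and g: "g \<in> Hom C A D"
    using assms by auto
  have 1: "A \<in> Obj C" "\<forall>x\<in>set [f, g]. x \<in> Arr C \<and> Dom C x = A"
    using f g by auto
  have cod: "map (Cod C) [f, g] = [B, D]"
    using f g by simp
  have 2: "h \<in> Hom C A (Cop C (map (Cod C) [f, g]))"
    using assms(1) unfolding cod .
  have 3: "h \<cdot> quasi_proj C (map (Cod C) [f, g]) j = [f, g] ! j" if "j < length [f, g]" for j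
    using that assms(4,5) unfolding cod by (cases j) simp_all
  show "perp C f g" "row C A [f, g] = h"
    using row_eqI[OF 1 2 3] f by (simp_all add: perp_def)
qed

text \<open>Any map with components \<open>f\<close> and \<open>g\<close> is their row, so a join
  can be computed without exhibiting the decision.\<close>

lemma join_eq:
  assumes "h \<in> Hom C A (Cop C [B, B])" "B \<in> Obj C"
    "h \<cdot> quasi_proj C [B, B] 0 = f" "h \<cdot> quasi_proj C [B, B] (Suc 0) = g"
  shows "f \<squnion> g = h \<cdot> codiag C 2 B"
  using pair_row[OF assms(1,2,2,3,4)] by (simp add: join_def row_def)

lemma wand_eq:
  assumes "h \<in> Hom C X (Cop C [X, A])" "X \<in> Obj C" "A \<in> Obj C"
    "h \<cdot> quasi_proj C [X, A] 0 = f1" "h \<cdot> quasi_proj C [X, A] (Suc 0) = f2"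
  shows "wand C Iter f1 f2 = Iter X A h"
  using pair_row[OF assms] by (simp add: wand_def)

text \<open>Disjoint pairs are precisely the pairs of components of maps into
  \<open>Cop C [X, A]\<close>. This exchanges the quantifiers of (a)-(c) for those of the axioms on
  \<open>Iter\<close>.\<close>

lemma ball_perp_iff:
  assumes "X \<in> Obj C" "A \<in> Obj C" "Y \<in> Obj C"
  shows "(\<forall>f1\<in>Hom C Y X. \<forall>f2\<in>Hom C Y A. perp C f1 f2 \<longrightarrow> P f1 f2) \<longleftrightarrow>
    (\<forall>f\<in>Hom C Y (Cop C [X, A]). P (f \<cdot> quasi_proj C [X, A] 0) (f \<cdot> quasi_proj C [X, A] (Suc 0)))"
proof safe
  fix f assume *: "\<forall>f1\<in>Hom C Y X. \<forall>f2\<in>Hom C Y A. perp C f1 f2 \<longrightarrow> P f1 f2"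
    and f: "f \<in> Hom C Y (Cop C [X, A])"
  from * pair_row[OF f assms(1,2) refl refl]
  show "P (f \<cdot> quasi_proj C [X, A] 0) (f \<cdot> quasi_proj C [X, A] (Suc 0))"
    by blast
next
  fix f1 f2
  assume *: "\<forall>f\<in>Hom C Y (Cop C [X, A]).
      P (f \<cdot> quasi_proj C [X, A] 0) (f \<cdot> quasi_proj C [X, A] (Suc 0))"
    and "f1 \<in> Hom C Y X" "f2 \<in> Hom C Y A" "perp C f1 f2"
  then obtain f where "f \<in> Hom C Y (Cop C [X, A])"
    "f \<cdot> quasi_proj C [X, A] 0 = f1" "f \<cdot> quasi_proj C [X, A] (Suc 0) = f2"
    by (blast elim: perpE)
  with * show "P f1 f2"
    by blast
qed

subsection \<open>Translation of the iteration axioms\<close>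

text \<open>With \<open>w\<close> the iterate of \<open>f\<close>, this turns the left-hand side of
  (a) into that of the parametrized iteration axiom.\<close>

lemma join_Comp_eq:
  assumes "X \<in> Obj C" "A \<in> Obj C" "f \<in> Hom C Y (Cop C [X, A])" "w \<in> Hom C X A"
  shows "(f \<cdot> quasi_proj C [X, A] (Suc 0)) \<squnion> (f \<cdot> quasi_proj C [X, A] 0 \<cdot> w) =
    f \<cdot> copair C A [w, Id C A]"
proof -
  \<comment> \<open>The two summands are interchanged because the join lists the exit component
    first and the looping component, followed by \<open>w\<close>, second.\<close>
  let ?m = "copair C (Cop C [A, A]) [w \<cdot> Inj C [A, A] (Suc 0), Inj C [A, A] 0]"
  have m: "?m \<in> Hom C (Cop C [X, A]) (Cop C [A, A])"
    using assms by simp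
  have 0: "?m \<cdot> quasi_proj C [A, A] 0 = quasi_proj C [X, A] (Suc 0)"
    by (rule Cop_ext2[of X A]) (use assms in simp_all)
  have 1: "?m \<cdot> quasi_proj C [A, A] (Suc 0) = quasi_proj C [X, A] 0 \<cdot> w"
    by (rule Cop_ext2[of X A]) (use assms in simp_all)
  have 2: "?m \<cdot> codiag C 2 A = copair C A [w, Id C A]"
    by (rule Cop_ext2[of X A]) (use assms in \<open>simp_all add: replicate_2\<close>)
  have "(f \<cdot> quasi_proj C [X, A] (Suc 0)) \<squnion> (f \<cdot> quasi_proj C [X, A] 0 \<cdot> w) =
      (f \<cdot> ?m) \<cdot> codiag C 2 A"
    using assms m 0 1 by (intro join_eq) auto
  then show ?thesis
    using assms m 2 by (simp add: replicate_2)
qed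

lemma wand_iteration_iff:
  assumes "operator_family C Iter"
  shows "wand_iteration C Iter \<longleftrightarrow>
    (\<forall>X\<in>Obj C. \<forall>A\<in>Obj C. \<forall>f\<in>Hom C X (Cop C [X, A]).
        f \<cdot> copair C A [Iter X A f, Id C A] = Iter X A f)"
  unfolding wand_iteration_def
proof (rule ball_cong[OF refl], rule ball_cong[OF refl])
  fix X A assume XA: "X \<in> Obj C" "A \<in> Obj C"
  show "(\<forall>f1\<in>Hom C X X. \<forall>f2\<in>Hom C X A. perp C f1 f2 \<longrightarrow>
        f2 \<squnion> (f1 \<cdot> wand C Iter f1 f2) = wand C Iter f1 f2) \<longleftrightarrow>
     (\<forall>f\<in>Hom C X (Cop C [X, A]). f \<cdot> copair C A [Iter X A f, Id C A] = Iter X A f)"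
    unfolding ball_perp_iff[OF XA(1,2,1)]
  proof (intro ball_cong refl)
    fix f assume f: "f \<in> Hom C X (Cop C [X, A])"
    have w: "Iter X A f \<in> Hom C X A"
      using assms XA f unfolding operator_family_def by blast
    show "(f \<cdot> quasi_proj C [X, A] (Suc 0) \<squnion> (f \<cdot> quasi_proj C [X, A] 0 \<cdot>
        wand C Iter (f \<cdot> quasi_proj C [X, A] 0) (f \<cdot> quasi_proj C [X, A] (Suc 0))) =
        wand C Iter (f \<cdot> quasi_proj C [X, A] 0) (f \<cdot> quasi_proj C [X, A] (Suc 0))) =
      (f \<cdot> copair C A [Iter X A f, Id C A] = Iter X A f)"
      unfolding wand_eq[OF f XA refl refl] join_Comp_eq[OF XA f w] ..
  qed
qed

lemma wand_naturality_iff: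
  "wand_naturality C Iter \<longleftrightarrow>
    (\<forall>X\<in>Obj C. \<forall>A'\<in>Obj C. \<forall>A\<in>Obj C. \<forall>f\<in>Hom C X (Cop C [X, A']). \<forall>h\<in>Hom C A' A.
        Iter X A (f \<cdot> cosum C [Id C X, h]) = Iter X A' f \<cdot> h)"
proof -
  have "(\<forall>f1\<in>Hom C X X. \<forall>f2\<in>Hom C X A'. \<forall>h\<in>Hom C A' A. perp C f1 f2 \<longrightarrow>
        wand C Iter f1 (f2 \<cdot> h) = wand C Iter f1 f2 \<cdot> h) \<longleftrightarrow>
     (\<forall>f\<in>Hom C X (Cop C [X, A']). \<forall>h\<in>Hom C A' A.
        Iter X A (f \<cdot> cosum C [Id C X, h]) = Iter X A' f \<cdot> h)" (is "?L \<longleftrightarrow> _")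
    if X: "X \<in> Obj C" and A': "A' \<in> Obj C" and A: "A \<in> Obj C" for X A' A
  proof -
    \<comment> \<open>Disjointness does not involve \<open>h\<close>; moving it outward gives the
      shape of \<open>ball_perp_iff\<close>.\<close>
    have "?L \<longleftrightarrow> (\<forall>f1\<in>Hom C X X. \<forall>f2\<in>Hom C X A'. perp C f1 f2 \<longrightarrow>
        (\<forall>h\<in>Hom C A' A. wand C Iter f1 (f2 \<cdot> h) = wand C Iter f1 f2 \<cdot> h))"
      by blast
    also have "\<dots> \<longleftrightarrow> (\<forall>f\<in>Hom C X (Cop C [X, A']). \<forall>h\<in>Hom C A' A.
        wand C Iter (f \<cdot> quasi_proj C [X, A'] 0) (f \<cdot> quasi_proj C [X, A'] (Suc 0) \<cdot> h) =
        wand C Iter (f \<cdot> quasi_proj C [X, A'] 0) (f \<cdot> quasi_proj C [X, A'] (Suc 0)) \<cdot> h)"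
      by (rule ball_perp_iff[OF X A' X])
    also have "\<dots> \<longleftrightarrow> (\<forall>f\<in>Hom C X (Cop C [X, A']). \<forall>h\<in>Hom C A' A.
        Iter X A (f \<cdot> cosum C [Id C X, h]) = Iter X A' f \<cdot> h)"
    proof (intro ball_cong refl)
      fix f h assume f: "f \<in> Hom C X (Cop C [X, A'])" and h: "h \<in> Hom C A' A"
      \<comment> \<open>Postcomposing with \<open>1 + h\<close> keeps the first component and
        follows the second by \<open>h\<close>.\<close>
      have "wand C Iter (f \<cdot> quasi_proj C [X, A'] 0) (f \<cdot> quasi_proj C [X, A'] (Suc 0) \<cdot> h) =
          Iter X A (f \<cdot> cosum C [Id C X, h])"
        using X A' A f h by (intro wand_eq) (auto simp: cosum_quasi_proj)
      then show "(wand C Iter (f \<cdot> quasi_proj C [X, A'] 0) (f \<cdot> quasi_proj C [X, A'] (Suc 0) \<cdot> h) =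
        wand C Iter (f \<cdot> quasi_proj C [X, A'] 0) (f \<cdot> quasi_proj C [X, A'] (Suc 0)) \<cdot> h) =
        (Iter X A (f \<cdot> cosum C [Id C X, h]) = Iter X A' f \<cdot> h)"
        unfolding wand_eq[OF f X A' refl refl] by simp
    qed
    finally show ?thesis .
  qed
  then show ?thesis
    unfolding wand_naturality_def by simp
qed

lemma wand_dinaturality_iff:
  "wand_dinaturality C Iter \<longleftrightarrow>
    (\<forall>X\<in>Obj C. \<forall>X'\<in>Obj C. \<forall>A\<in>Obj C. \<forall>f\<in>Hom C X' (Cop C [X, A]). \<forall>k\<in>Hom C X X'.
        Iter X A (k \<cdot> f) = k \<cdot> Iter X' A (f \<cdot> cosum C [k, Id C A]))"
proof -
  have "(\<forall>f1\<in>Hom C X' X. \<forall>f2\<in>Hom C X' A. \<forall>k\<in>Hom C X X'. perp C f1 f2 \<longrightarrow>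
        wand C Iter (k \<cdot> f1) (k \<cdot> f2) = k \<cdot> wand C Iter (f1 \<cdot> k) f2) \<longleftrightarrow>
     (\<forall>f\<in>Hom C X' (Cop C [X, A]). \<forall>k\<in>Hom C X X'.
        Iter X A (k \<cdot> f) = k \<cdot> Iter X' A (f \<cdot> cosum C [k, Id C A]))" (is "?L \<longleftrightarrow> _")
    if X: "X \<in> Obj C" and X': "X' \<in> Obj C" and A: "A \<in> Obj C" for X X' A
  proof -
    have "?L \<longleftrightarrow> (\<forall>f1\<in>Hom C X' X. \<forall>f2\<in>Hom C X' A. perp C f1 f2 \<longrightarrow>
        (\<forall>k\<in>Hom C X X'. wand C Iter (k \<cdot> f1) (k \<cdot> f2) = k \<cdot> wand C Iter (f1 \<cdot> k) f2))"
      by blast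
    also have "\<dots> \<longleftrightarrow> (\<forall>f\<in>Hom C X' (Cop C [X, A]). \<forall>k\<in>Hom C X X'.
        wand C Iter (k \<cdot> (f \<cdot> quasi_proj C [X, A] 0)) (k \<cdot> (f \<cdot> quasi_proj C [X, A] (Suc 0))) =
        k \<cdot> wand C Iter (f \<cdot> quasi_proj C [X, A] 0 \<cdot> k) (f \<cdot> quasi_proj C [X, A] (Suc 0)))"
      by (rule ball_perp_iff[OF X A X'])
    also have "\<dots> \<longleftrightarrow> (\<forall>f\<in>Hom C X' (Cop C [X, A]). \<forall>k\<in>Hom C X X'.
        Iter X A (k \<cdot> f) = k \<cdot> Iter X' A (f \<cdot> cosum C [k, Id C A]))"
    proof (intro ball_cong refl)
      fix f k assume f: "f \<in> Hom C X' (Cop C [X, A])" and k: "k \<in> Hom C X X'"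
      have 1: "wand C Iter (k \<cdot> (f \<cdot> quasi_proj C [X, A] 0))
          (k \<cdot> (f \<cdot> quasi_proj C [X, A] (Suc 0))) = Iter X A (k \<cdot> f)"
        using X X' A f k by (intro wand_eq) auto
      \<comment> \<open>Here the sum \<open>k + 1\<close> changes only the looping component,
        whereas precomposition by \<open>k\<close> changed both.\<close>
      have 2: "wand C Iter (f \<cdot> quasi_proj C [X, A] 0 \<cdot> k) (f \<cdot> quasi_proj C [X, A] (Suc 0)) =
          Iter X' A (f \<cdot> cosum C [k, Id C A])"
        using X X' A f k by (intro wand_eq) (auto simp: cosum_quasi_proj)
      show "(wand C Iter (k \<cdot> (f \<cdot> quasi_proj C [X, A] 0))
          (k \<cdot> (f \<cdot> quasi_proj C [X, A] (Suc 0))) =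
        k \<cdot> wand C Iter (f \<cdot> quasi_proj C [X, A] 0 \<cdot> k) (f \<cdot> quasi_proj C [X, A] (Suc 0))) =
        (Iter X A (k \<cdot> f) = k \<cdot> Iter X' A (f \<cdot> cosum C [k, Id C A]))"
        unfolding 1 2 ..
    qed
    finally show ?thesis .
  qed
  then show ?thesis
    unfolding wand_dinaturality_def by simp
qed

text \<open>The equation in \<open>uniform\<close> is between maps into \<open>Cop C [Y, A]\<close>;
  its two components are the two equations assumed in (e).\<close>

lemma wand_uniformity_iff: "wand_uniformity C Iter \<longleftrightarrow> uniform C Iter"
proof -
  have eq: "(f \<cdot> cosum C [h, Id C A] = h \<cdot> f') \<longleftrightarrow>
      h \<cdot> (f' \<cdot> quasi_proj C [Y, A] 0) = f \<cdot> quasi_proj C [X, A] 0 \<cdot> h \<and>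
      f \<cdot> quasi_proj C [X, A] (Suc 0) = h \<cdot> (f' \<cdot> quasi_proj C [Y, A] (Suc 0))" (is "?l = ?r \<longleftrightarrow> _")
    if "X \<in> Obj C" "Y \<in> Obj C" "A \<in> Obj C" "f \<in> Hom C X (Cop C [X, A])"
      "f' \<in> Hom C Y (Cop C [Y, A])" "h \<in> Hom C X Y" for X Y A f f' h
  proof -
    have c: "?l \<cdot> quasi_proj C [Y, A] 0 = f \<cdot> quasi_proj C [X, A] 0 \<cdot> h"
      "?l \<cdot> quasi_proj C [Y, A] (Suc 0) = f \<cdot> quasi_proj C [X, A] (Suc 0)"
      "?r \<cdot> quasi_proj C [Y, A] 0 = h \<cdot> (f' \<cdot> quasi_proj C [Y, A] 0)"
      "?r \<cdot> quasi_proj C [Y, A] (Suc 0) = h \<cdot> (f' \<cdot> quasi_proj C [Y, A] (Suc 0))"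
      using that by (auto simp: cosum_quasi_proj)
    have "?l = ?r \<longleftrightarrow> ?l \<cdot> quasi_proj C [Y, A] 0 = ?r \<cdot> quasi_proj C [Y, A] 0 \<and>
        ?l \<cdot> quasi_proj C [Y, A] (Suc 0) = ?r \<cdot> quasi_proj C [Y, A] (Suc 0)" (is "_ \<longleftrightarrow> ?R")
    proof
      show "?l = ?r" if ?R
      proof (rule quasi_proj_jointly_monic[of "[Y, A]" _ X])
        show "?l \<cdot> quasi_proj C [Y, A] j = ?r \<cdot> quasi_proj C [Y, A] j" if "j < length [Y, A]" for j
          using that \<open>?R\<close> by (cases j) simp_all
      qed (use \<open>X \<in> Obj C\<close> \<open>Y \<in> Obj C\<close> \<open>A \<in> Obj C\<close> \<open>f \<in> _\<close> \<open>f' \<in> _\<close> \<open>h \<in> _\<close> in simp_all)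
    qed simp
    then show ?thesis
      unfolding c by auto
  qed
  show ?thesis
  proof
    assume u: "uniform C Iter"
    show "wand_uniformity C Iter"
      unfolding wand_uniformity_def
    proof (intro ballI impI)
      fix X Y A f1 f2 f1' f2' h
      assume *: "X \<in> Obj C" "Y \<in> Obj C" "A \<in> Obj C" "h \<in> Hom C X Y"
        "h \<cdot> f1' = f1 \<cdot> h" "f2 = h \<cdot> f2'"
        and **: "f1 \<in> Hom C X X" "f2 \<in> Hom C X A" "f1' \<in> Hom C Y Y" "f2' \<in> Hom C Y A"
        "perp C f1 f2" "perp C f1' f2'"
      obtain f where f: "f \<in> Hom C X (Cop C [X, A])" "f \<cdot> quasi_proj C [X, A] 0 = f1"
          "f \<cdot> quasi_proj C [X, A] (Suc 0) = f2"
        using ** by (blast elim: perpE)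
      obtain f' where f': "f' \<in> Hom C Y (Cop C [Y, A])" "f' \<cdot> quasi_proj C [Y, A] 0 = f1'"
          "f' \<cdot> quasi_proj C [Y, A] (Suc 0) = f2'"
        using ** by (blast elim: perpE)
      have "f \<cdot> cosum C [h, Id C A] = h \<cdot> f'"
        using eq[of X Y A f f' h] f f' * by blast
      then have "Iter X A f = h \<cdot> Iter Y A f'"
        using u * f f' unfolding uniform_def by blast
      then show "wand C Iter f1 f2 = h \<cdot> wand C Iter f1' f2'"
        using wand_eq[OF f(1) *(1,3) f(2,3)] wand_eq[OF f'(1) *(2,3) f'(2,3)] by simp
    qed
  next
    assume w: "wand_uniformity C Iter"
    show "uniform C Iter"
      unfolding uniform_def
    proof (intro ballI impI)
      fix X Y A f f' h
      assume *: "X \<in> Obj C" "Y \<in> Obj C" "A \<in> Obj C" "h \<in> Hom C X Y"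
        and f: "f \<in> Hom C X (Cop C [X, A])" and f': "f' \<in> Hom C Y (Cop C [Y, A])"
        and e: "f \<cdot> cosum C [h, Id C A] = h \<cdot> f'"
      note p = pair_row[OF f *(1,3) refl refl] and p' = pair_row[OF f' *(2,3) refl refl]
      from e eq[OF *(1-3) f f' *(4)] w * p p'
      have "wand C Iter (f \<cdot> quasi_proj C [X, A] 0) (f \<cdot> quasi_proj C [X, A] (Suc 0)) =
        h \<cdot> wand C Iter (f' \<cdot> quasi_proj C [Y, A] 0) (f' \<cdot> quasi_proj C [Y, A] (Suc 0))"
        unfolding wand_uniformity_def by blast
      then show "Iter X A f = h \<cdot> Iter Y A f'"
        unfolding wand_eq[OF f *(1,3) refl refl] wand_eq[OF f' *(2,3) refl refl] .
    qed
  qed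
qed

section \<open>The diagonal axiom and ternary coproducts\<close>

lemma assoc_right_components:
  assumes "X \<in> Obj C" "Y \<in> Obj C" "Z \<in> Obj C"
  shows "assoc_right C X Y Z \<cdot> quasi_proj C [X, Cop C [Y, Z]] 0 = quasi_proj C [X, Y, Z] 0"
    "assoc_right C X Y Z \<cdot> (quasi_proj C [X, Cop C [Y, Z]] (Suc 0) \<cdot> quasi_proj C [Y, Z] 0) =
      quasi_proj C [X, Y, Z] (Suc 0)"
    "assoc_right C X Y Z \<cdot> (quasi_proj C [X, Cop C [Y, Z]] (Suc 0) \<cdot> quasi_proj C [Y, Z] (Suc 0)) =
      quasi_proj C [X, Y, Z] (Suc (Suc 0))"
  unfolding assoc_right_def
  by (rule Cop_ext3[of X Y Z]; use assms in simp)+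

text \<open>The column found for the looping component is zero on \<open>A\<close>;
  \<open>join_triple_eq\<close> recognizes it as the join of the first two components.\<close>

lemma assoc_left_codiag_components:
  assumes "X \<in> Obj C" "A \<in> Obj C"
  shows "assoc_left C X X A \<cdot> (cosum C [codiag C 2 X, Id C A] \<cdot> quasi_proj C [X, A] 0) =
      copair C X [Id C X, Id C X, Zero C A X]"
    "assoc_left C X X A \<cdot> (cosum C [codiag C 2 X, Id C A] \<cdot> quasi_proj C [X, A] (Suc 0)) =
      quasi_proj C [X, X, A] (Suc (Suc 0))"
  unfolding assoc_left_def
  by (rule Cop_ext3[of X X A]; use assms in \<open>simp add: replicate_2\<close>)+

lemma join_triple_eq:
  assumes "X \<in> Obj C" "A \<in> Obj C" "f \<in> Hom C Y (Cop C [X, X, A])"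
  shows "(f \<cdot> quasi_proj C [X, X, A] 0) \<squnion> (f \<cdot> quasi_proj C [X, X, A] (Suc 0)) =
    f \<cdot> copair C X [Id C X, Id C X, Zero C A X]"
proof -
  \<comment> \<open>Killing the summand \<open>A\<close> leaves a map into \<open>X + X\<close> with
    the first two components of \<open>f\<close>, so its codiagonal is their join.\<close>
  let ?m = "copair C (Cop C [X, X]) [Inj C [X, X] 0, Inj C [X, X] (Suc 0), Zero C A (Cop C [X, X])]"
  have m: "?m \<in> Hom C (Cop C [X, X, A]) (Cop C [X, X])"
    using assms by simp
  have 0: "?m \<cdot> quasi_proj C [X, X] 0 = quasi_proj C [X, X, A] 0"
    by (rule Cop_ext3[of X X A]) (use assms in simp_all)
  have 1: "?m \<cdot> quasi_proj C [X, X] (Suc 0) = quasi_proj C [X, X, A] (Suc 0)"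
    by (rule Cop_ext3[of X X A]) (use assms in simp_all)
  have 2: "?m \<cdot> codiag C 2 X = copair C X [Id C X, Id C X, Zero C A X]"
    by (rule Cop_ext3[of X X A]) (use assms in \<open>simp_all add: replicate_2\<close>)
  have "(f \<cdot> quasi_proj C [X, X, A] 0) \<squnion> (f \<cdot> quasi_proj C [X, X, A] (Suc 0)) =
      (f \<cdot> ?m) \<cdot> codiag C 2 X"
    using assms m 0 1 by (intro join_eq) auto
  then show ?thesis
    using assms m 2 by (simp add: replicate_2)
qed

lemma tripleE:
  assumes "A \<in> Obj C" "f \<in> Hom C A B" "g \<in> Hom C A D" "k \<in> Hom C A E"
    "decision_disjoint C A [f, g, k]"
  obtains h where "h \<in> Hom C A (Cop C [B, D, E])" "h \<cdot> quasi_proj C [B, D, E] 0 = f"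
    "h \<cdot> quasi_proj C [B, D, E] (Suc 0) = g" "h \<cdot> quasi_proj C [B, D, E] (Suc (Suc 0)) = k"
proof -
  obtain h where "h \<in> Hom C A (Cop C (map (Cod C) [f, g, k]))"
    "\<forall>j<length [f, g, k]. h \<cdot> quasi_proj C (map (Cod C) [f, g, k]) j = [f, g, k] ! j"
    using assms(1,5) by (rule decision_disjointE)
  then show thesis
    using assms that by auto
qed

lemma triple_decision_disjoint:
  assumes "f \<in> Hom C A (Cop C [B, D, E])" "B \<in> Obj C" "D \<in> Obj C" "E \<in> Obj C"
  shows "decision_disjoint C A [f \<cdot> quasi_proj C [B, D, E] 0, f \<cdot> quasi_proj C [B, D, E] (Suc 0),
    f \<cdot> quasi_proj C [B, D, E] (Suc (Suc 0))]"
  using assms by (intro row_eqI(1)[of _ _ f]) (auto simp: less_Suc_eq)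

text \<open>The inner iterate is \<open>[f1 | r]\<close>, where \<open>r\<close> is the component of
  the reassociated map in \<open>X + A\<close>. Naturality moves a quasi-projection of
  \<open>X + A\<close> inside the iteration, onto \<open>r\<close>, whose components are
  \<open>f2\<close> and \<open>f3\<close>.\<close>

lemma Iter_assoc_right_components:
  assumes "operator_family C Iter" "wand_naturality C Iter" "X \<in> Obj C" "A \<in> Obj C"
    "f \<in> Hom C X (Cop C [X, X, A])" "f \<cdot> quasi_proj C [X, X, A] 0 = f1"
    "f \<cdot> quasi_proj C [X, X, A] (Suc 0) = f2" "f \<cdot> quasi_proj C [X, X, A] (Suc (Suc 0)) = f3"
  defines "w \<equiv> Iter X (Cop C [X, A]) (f \<cdot> assoc_right C X X A)"
  shows "w \<in> Hom C X (Cop C [X, A])"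
    "w \<cdot> quasi_proj C [X, A] 0 = wand C Iter f1 f2"
    "w \<cdot> quasi_proj C [X, A] (Suc 0) = wand C Iter f1 f3"
proof -
  let ?g = "f \<cdot> assoc_right C X X A"
  let ?r = "?g \<cdot> quasi_proj C [X, Cop C [X, A]] (Suc 0)"
  have obj: "Cop C [X, A] \<in> Obj C"
    using assms(3,4) by simp
  have g: "?g \<in> Hom C X (Cop C [X, Cop C [X, A]])"
    using assms(3-5) by simp
  then show "w \<in> Hom C X (Cop C [X, A])"
    using assms(1,3) obj unfolding operator_family_def w_def by blast
  have g0: "?g \<cdot> quasi_proj C [X, Cop C [X, A]] 0 = f1"
    using assms(3-6) by (simp add: assoc_right_components)
  note p = pair_row[OF g assms(3) obj g0 refl]
  have w: "w = wand C Iter f1 ?r"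
    unfolding w_def by (rule wand_eq[OF g assms(3) obj g0 refl, symmetric])
  have nat: "wand C Iter f1 (?r \<cdot> h) = w \<cdot> h" if "h \<in> Hom C (Cop C [X, A]) B" for h B
  proof -
    have "B \<in> Obj C"
      using that by auto
    then show ?thesis
      using assms(2,3) obj p(1,3,4) that unfolding w wand_naturality_def by blast
  qed
  have "?r \<cdot> quasi_proj C [X, A] 0 = f2" "?r \<cdot> quasi_proj C [X, A] (Suc 0) = f3"
    using assms(3-5,7,8) by (auto simp: assoc_right_components)
  then show "w \<cdot> quasi_proj C [X, A] 0 = wand C Iter f1 f2"
    "w \<cdot> quasi_proj C [X, A] (Suc 0) = wand C Iter f1 f3"
    using nat[of "quasi_proj C [X, A] 0" X] nat[of "quasi_proj C [X, A] (Suc 0)" A] assms(3,4)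
    by simp_all
qed

text \<open>The two iterates are the components of a single map into \<open>X + A\<close>, hence
  disjoint.\<close>

lemma wand_perp:
  assumes "operator_family C Iter" "wand_naturality C Iter" "X \<in> Obj C" "A \<in> Obj C"
    "f1 \<in> Hom C X X" "f2 \<in> Hom C X X" "f3 \<in> Hom C X A" "decision_disjoint C X [f1, f2, f3]"
  shows "perp C (wand C Iter f1 f2) (wand C Iter f1 f3)"
proof -
  obtain f where "f \<in> Hom C X (Cop C [X, X, A])" "f \<cdot> quasi_proj C [X, X, A] 0 = f1"
    "f \<cdot> quasi_proj C [X, X, A] (Suc 0) = f2" "f \<cdot> quasi_proj C [X, X, A] (Suc (Suc 0)) = f3"
    using tripleE[OF assms(3,5-8)] by blast
  from pair_row(1)[OF _ assms(3,4)] Iter_assoc_right_components[OF assms(1-4) this]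
  show ?thesis
    by blast
qed

lemma wand_diagonal_iff:
  assumes "operator_family C Iter" "wand_naturality C Iter"
  shows "wand_diagonal C Iter \<longleftrightarrow> (\<forall>X\<in>Obj C. \<forall>A\<in>Obj C. \<forall>f\<in>Hom C X (Cop C [X, X, A]).
        Iter X A (Iter X (Cop C [X, A]) (f \<cdot> assoc_right C X X A)) =
        Iter X A (f \<cdot> assoc_left C X X A \<cdot> cosum C [codiag C 2 X, Id C A]))"
proof -
  \<comment> \<open>On the left the inner iterate is the row of the two wands. On the right, merging
    the first two summands produces the join as looping component and leaves \<open>f3\<close> as
    exit.\<close>
  have eq: "wand C Iter (wand C Iter f1 f2) (wand C Iter f1 f3) =
        Iter X A (Iter X (Cop C [X, A]) (f \<cdot> assoc_right C X X A))"
    "wand C Iter (f1 \<squnion> f2) f3 =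
        Iter X A (f \<cdot> assoc_left C X X A \<cdot> cosum C [codiag C 2 X, Id C A])"
    if X: "X \<in> Obj C" "A \<in> Obj C" and f: "f \<in> Hom C X (Cop C [X, X, A])"
      and c: "f \<cdot> quasi_proj C [X, X, A] 0 = f1"
      "f \<cdot> quasi_proj C [X, X, A] (Suc 0) = f2" "f \<cdot> quasi_proj C [X, X, A] (Suc (Suc 0)) = f3"
    for X A f f1 f2 f3
  proof -
    note w = Iter_assoc_right_components[OF assms X f c]
    show "wand C Iter (wand C Iter f1 f2) (wand C Iter f1 f3) =
        Iter X A (Iter X (Cop C [X, A]) (f \<cdot> assoc_right C X X A))"
      by (rule wand_eq[OF w(1) X w(2,3)])
    show "wand C Iter (f1 \<squnion> f2) f3 =
        Iter X A (f \<cdot> assoc_left C X X A \<cdot> cosum C [codiag C 2 X, Id C A])"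
      using X f join_triple_eq[OF X f] c
      by (intro wand_eq) (auto simp: assoc_left_codiag_components replicate_2)
  qed
  show ?thesis
    unfolding wand_diagonal_def
  proof (rule ball_cong[OF refl], rule ball_cong[OF refl], intro iffI ballI impI)
    fix X A f assume X: "X \<in> Obj C" "A \<in> Obj C" and f: "f \<in> Hom C X (Cop C [X, X, A])"
      and d: "\<forall>f1\<in>Hom C X X. \<forall>f2\<in>Hom C X X. \<forall>f3\<in>Hom C X A.
        decision_disjoint C X [f1, f2, f3] \<longrightarrow>
        wand C Iter (wand C Iter f1 f2) (wand C Iter f1 f3) = wand C Iter (f1 \<squnion> f2) f3"
    have "f \<cdot> quasi_proj C [X, X, A] 0 \<in> Hom C X X" "f \<cdot> quasi_proj C [X, X, A] (Suc 0) \<in> Hom C X X"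
      "f \<cdot> quasi_proj C [X, X, A] (Suc (Suc 0)) \<in> Hom C X A"
      using X f by auto
    with d triple_decision_disjoint[OF f X(1,1,2)]
    show "Iter X A (Iter X (Cop C [X, A]) (f \<cdot> assoc_right C X X A)) =
        Iter X A (f \<cdot> assoc_left C X X A \<cdot> cosum C [codiag C 2 X, Id C A])"
      unfolding eq[OF X f refl refl refl, symmetric] by blast
  next
    fix X A f1 f2 f3 assume X: "X \<in> Obj C" "A \<in> Obj C"
      and d: "\<forall>f\<in>Hom C X (Cop C [X, X, A]).
        Iter X A (Iter X (Cop C [X, A]) (f \<cdot> assoc_right C X X A)) =
        Iter X A (f \<cdot> assoc_left C X X A \<cdot> cosum C [codiag C 2 X, Id C A])"
      and "f1 \<in> Hom C X X" "f2 \<in> Hom C X X" "f3 \<in> Hom C X A" "decision_disjoint C X [f1, f2, f3]"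
    then obtain f where "f \<in> Hom C X (Cop C [X, X, A])" "f \<cdot> quasi_proj C [X, X, A] 0 = f1"
      "f \<cdot> quasi_proj C [X, X, A] (Suc 0) = f2" "f \<cdot> quasi_proj C [X, X, A] (Suc (Suc 0)) = f3"
      using tripleE by blast
    from eq[OF X this] d this(1)
    show "wand C Iter (wand C Iter f1 f2) (wand C Iter f1 f3) = wand C Iter (f1 \<squnion> f2) f3"
      by simp
  qed
qed

text \<open>The diagonal axioms are matched only in the presence of naturality, which both sides of
  the equivalence supply.\<close>

lemma parametrized_iteration_operator_iff:
  assumes "operator_family C Iter"
  shows "parametrized_iteration_operator C Iter \<longleftrightarrow>
    wand_iteration C Iter \<and> wand_naturality C Iter \<and>
    wand_dinaturality C Iter \<and> wand_diagonal C Iter"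
  using assms wand_diagonal_iff[OF assms]
  unfolding parametrized_iteration_operator_def wand_iteration_iff[OF assms] wand_naturality_iff
    wand_dinaturality_iff
  by blast

end

theorem lemma9p8:
  fixes C :: "('o, 'a, 'm) extensive_data_scheme"
    and Iter :: "'o \<Rightarrow> 'o \<Rightarrow> 'a \<Rightarrow> 'a"
  assumes "extensive_restriction_category C"
    and "operator_family C Iter"
  shows "(parametrized_iteration_operator C Iter \<longleftrightarrow>
            wand_iteration C Iter \<and> wand_naturality C Iter \<and>
            wand_dinaturality C Iter \<and> wand_diagonal C Iter)
       \<and> (wand_naturality C Iter \<longrightarrow>
            (\<forall>X\<in>Obj C. \<forall>A\<in>Obj C. \<forall>f1\<in>Hom C X X. \<forall>f2\<in>Hom C X X. \<forall>f3\<in>Hom C X A.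
               decision_disjoint C X [f1, f2, f3] \<longrightarrow>
               perp C (wand C Iter f1 f2) (wand C Iter f1 f3)))
       \<and> (parametrized_iteration_operator C Iter \<and> uniform C Iter \<longleftrightarrow>
            wand_iteration C Iter \<and> wand_naturality C Iter \<and>
            wand_dinaturality C Iter \<and> wand_diagonal C Iter \<and> wand_uniformity C Iter)"
proof -
  interpret extensive_restriction_category C by fact
  show ?thesis
    using parametrized_iteration_operator_iff[OF assms(2)] wand_uniformity_iff[of Iter]
      wand_perp[OF assms(2)]
    by blast
qed

end
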